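(* Let $p=0.05$, $q=0.4$, let $\mathcal N_1(\rho)=q\rho+(1-q)\sigma_z\rho\sigma_z$ be the qubit dephasing channel, $\mathcal N_2(\rho)=(1-p)\rho+p\,(\operatorname{Tr}\rho)\,I/2$ the qubit depolarizing channel, and let $f(\rho)=-D(\sqrt{\rho}\,\Gamma^{\mathcal N_1}\sqrt{\rho}\,\|\,\sqrt{\rho}\,\Gamma^{\mathcal N_2}\sqrt{\rho})=\operatorname{Tr}[\rho\,\Omega(\rho)]$. Let $N_{\mathcal M}=\{cI:c\in\mathbb R\}$. Then $\Omega(\rho)-\nabla f(\rho)\in N_{\mathcal M}$ does not hold universally over the feasible set of all qubit states: there exists a positive-definite qubit density operator $\rho$ with $\Omega(\rho)-\nabla f(\rho)\notin N_{\mathcal M}$.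
   Context: $\mathcal H_A=\mathcal H_B=\mathbb C^2$; $\sigma_z$ is the Pauli $Z$ matrix; $\log$ is the natural logarithm. For a channel $\mathcal N$ from $A$ to $B$, the (unnormalized) Choi matrix is $\Gamma^{\mathcal N}=\sum_{i,j}|i\rangle\langle j|_A\otimes\mathcal N(|i\rangle\langle j|)_B$. $D(\sigma\|\tau)=\operatorname{Tr}\,\sigma(\log\sigma-\log\tau)$. For a positive-definite state $\rho$ on $A$, powers of $\rho$ are understood as acting as $\rho^{s}\otimes I_B$, and $$\Omega_1(\rho)=-\operatorname{Tr}_B\!\big(\Gamma^{\mathcal N_1}\rho^{1/2}\big(\log(\rho^{1/2}\Gamma^{\mathcal N_1}\rho^{1/2})-\log(\rho^{1/2}\Gamma^{\mathcal N_2}\rho^{1/2})\big)\rho^{-1/2}\big),\qquad \Omega(\rho)=\tfrac12(\Omega_1(\rho)+\Omega_1(\rho)^\dagger),$$ where the logarithm of the singular operator $\rho^{1/2}\Gamma^{\mathcal N_1}\rho^{1/2}$ is taken on its support (and is $0$ on its kernel). $\nabla f(\rho)$ is the gradient with respect to the Hilbert–Schmidt inner product: a Hermitian matrix with $Df(\rho)[X]=\operatorname{Tr}[X\nabla f(\rho)]$ for all traceless Hermitian $X$ (determined up to adding multiples of $I$). *)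

theory Defs
  imports "HOL-Analysis.Analysis"
begin

section \<open>Complex matrices\<close>

definition adj :: "complex^'n^'m \<Rightarrow> complex^'m^'n" where
  "adj A = (\<chi> i j. cnj (A $ j $ i))"

definition hermitian :: "complex^'n^'n \<Rightarrow> bool" where
  "hermitian A \<longleftrightarrow> adj A = A"

definition unitary :: "complex^'n^'n \<Rightarrow> bool" where
  "unitary U \<longleftrightarrow> adj U ** U = mat 1 \<and> U ** adj U = mat 1"

definition positive_definite :: "complex^'n^'n \<Rightarrow> bool" where
  "positive_definite A \<longleftrightarrow> hermitian A \<and>
     (\<forall>v. v \<noteq> 0 \<longrightarrow> 0 < Re (\<Sum>i\<in>UNIV. cnj (v $ i) * (A *v v) $ i))"

definition real_diag :: "('n \<Rightarrow> real) \<Rightarrow> complex^'n^'n" where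
  "real_diag d = (\<chi> i j. if i = j then complex_of_real (d i) else 0)"

text \<open>Functional calculus for Hermitian matrices. The value does not depend on the chosen
  diagonalization (lemma \<open>herm_fun_eq\<close>); for non-Hermitian arguments it is unspecified.\<close>

definition herm_fun :: "(real \<Rightarrow> real) \<Rightarrow> complex^'n^'n \<Rightarrow> complex^'n^'n" where
  "herm_fun g A = (THE B. \<exists>U d. unitary U \<and> A = U ** real_diag d ** adj U \<and>
                                B = U ** real_diag (g \<circ> d) ** adj U)"

lemma real_diag_intertwine:
  fixes W :: "complex^'n^'n"
  assumes "W ** real_diag d = real_diag e ** W"
  shows "W ** real_diag (g \<circ> d) = real_diag (g \<circ> e) ** W"
proof -
  have R: "(W ** real_diag d) $ i $ j = W $ i $ j * complex_of_real (d j)"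
    and L: "(real_diag d ** W) $ i $ j = complex_of_real (d i) * W $ i $ j"
    for W :: "complex^'n^'n" and d i j
    by (simp_all add: matrix_matrix_mult_def real_diag_def if_distrib if_distribR cong: if_cong)
  have "W $ i $ j * complex_of_real (g (d j)) = complex_of_real (g (e i)) * W $ i $ j" for i j
  proof (cases "W $ i $ j = 0")
    case False
    have "W $ i $ j * complex_of_real (d j) = complex_of_real (e i) * W $ i $ j"
      using assms by (metis L R)
    with False have "d j = e i" by simp
    then show ?thesis by simp
  qed simp
  then show ?thesis by (simp add: vec_eq_iff R L)
qed

lemma herm_fun_eq:
  assumes "unitary U"
  shows "herm_fun g (U ** real_diag d ** adj U) = U ** real_diag (g \<circ> d) ** adj U"
  unfolding herm_fun_def
proof (rule the_equality)
  show "\<exists>V e. unitary V \<and> U ** real_diag d ** adj U = V ** real_diag e ** adj V \<and>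
          U ** real_diag (g \<circ> d) ** adj U = V ** real_diag (g \<circ> e) ** adj V"
    using assms by blast
next
  fix B
  assume "\<exists>V e. unitary V \<and> U ** real_diag d ** adj U = V ** real_diag e ** adj V \<and>
          B = V ** real_diag (g \<circ> e) ** adj V"
  then obtain V e where V: "unitary V"
    and eq: "U ** real_diag d ** adj U = V ** real_diag e ** adj V"
    and B: "B = V ** real_diag (g \<circ> e) ** adj V" by blast
  have "adj V ** (U ** real_diag d ** adj U) ** U = adj V ** (V ** real_diag e ** adj V) ** U"
    by (simp add: eq)
  moreover have "adj V ** (U ** real_diag d ** adj U) ** U
                 = (adj V ** U) ** real_diag d ** (adj U ** U)"
    by (simp add: matrix_mul_assoc)
  moreover have "adj V ** (V ** real_diag e ** adj V) ** U
                 = (adj V ** V) ** real_diag e ** (adj V ** U)"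
    by (simp add: matrix_mul_assoc)
  ultimately have "(adj V ** U) ** real_diag d = real_diag e ** (adj V ** U)"
    using assms V by (simp add: unitary_def)
  then have "(adj V ** U) ** real_diag (g \<circ> d) = real_diag (g \<circ> e) ** (adj V ** U)"
    by (rule real_diag_intertwine)
  then have "V ** ((adj V ** U) ** real_diag (g \<circ> d)) ** adj U
             = V ** (real_diag (g \<circ> e) ** (adj V ** U)) ** adj U"
    by simp
  moreover have "V ** ((adj V ** U) ** real_diag (g \<circ> d)) ** adj U
                 = (V ** adj V) ** (U ** real_diag (g \<circ> d) ** adj U)"
    by (simp add: matrix_mul_assoc)
  moreover have "V ** (real_diag (g \<circ> e) ** (adj V ** U)) ** adj U
                 = V ** real_diag (g \<circ> e) ** adj V ** (U ** adj U)"
    by (simp add: matrix_mul_assoc)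
  ultimately show "B = U ** real_diag (g \<circ> d) ** adj U"
    using assms V B by (simp add: unitary_def)
qed

definition herm_powr :: "complex^'n^'n \<Rightarrow> real \<Rightarrow> complex^'n^'n" where
  "herm_powr A s = herm_fun (\<lambda>x. x powr s) A"

text \<open>Logarithm of a positive semidefinite matrix on its support, zero on its kernel.\<close>

definition log_supp :: "complex^'n^'n \<Rightarrow> complex^'n^'n" where
  "log_supp A = herm_fun (\<lambda>x. if x > 0 then ln x else 0) A"

text \<open>The trace is real for Hermitian arguments, so \<^const>\<open>Re\<close> only adjusts the type. The formula
  is the relative entropy only if the support of \<open>\<tau>\<close> contains that of \<open>\<sigma>\<close>, in particular for
  positive definite \<open>\<tau>\<close>; the usual value \<open>\<infinity>\<close> in the remaining case is not modelled.\<close>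

definition rel_entropy :: "complex^'n^'n \<Rightarrow> complex^'n^'n \<Rightarrow> real" where
  "rel_entropy \<sigma> \<tau> = Re (trace (\<sigma> ** (log_supp \<sigma> - log_supp \<tau>)))"

section \<open>Bipartite systems and channels\<close>

text \<open>The system \<open>AB\<close> is indexed by pairs, the first component belonging to \<open>A\<close>.\<close>

definition tensor ::
  "complex^'a^'a \<Rightarrow> complex^'b^'b \<Rightarrow> complex^('a::finite \<times> 'b::finite)^('a \<times> 'b)" where
  "tensor X Y = (\<chi> r c. X $ fst r $ fst c * Y $ snd r $ snd c)"

definition ptrace_B :: "complex^('a::finite \<times> 'b::finite)^('a \<times> 'b) \<Rightarrow> complex^'a^'a" where
  "ptrace_B M = (\<chi> i j. \<Sum>k\<in>UNIV. M $ (i, k) $ (j, k))"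

definition mat_unit :: "'a \<Rightarrow> 'a \<Rightarrow> complex^'a^'a" where
  "mat_unit i j = (\<chi> k l. if k = i \<and> l = j then 1 else 0)"

definition choi ::
  "(complex^'a^'a \<Rightarrow> complex^'b^'b) \<Rightarrow> complex^('a::finite \<times> 'b::finite)^('a \<times> 'b)" where
  "choi \<N> = (\<Sum>i\<in>UNIV. \<Sum>j\<in>UNIV. tensor (mat_unit i j) (\<N> (mat_unit i j)))"

definition pauli_z :: "complex^2^2" where
  "pauli_z = vector [vector [1, 0], vector [0, -1]]"

definition dephasing :: "real \<Rightarrow> complex^2^2 \<Rightarrow> complex^2^2" where
  "dephasing q \<rho> = q *\<^sub>R \<rho> + (1 - q) *\<^sub>R (pauli_z ** \<rho> ** pauli_z)"

definition depolarizing :: "real \<Rightarrow> complex^2^2 \<Rightarrow> complex^2^2" where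
  "depolarizing p \<rho> = (1 - p) *\<^sub>R \<rho> + p *\<^sub>R mat (trace \<rho> / 2)"

text \<open>The power \<open>\<rho>\<^sup>s\<close> on \<open>A\<close>, acting on \<open>AB\<close>.\<close>

definition powA :: "complex^'a^'a \<Rightarrow> real \<Rightarrow> complex^('a::finite \<times> 'b::finite)^('a \<times> 'b)" where
  "powA \<rho> s = tensor (herm_powr \<rho> s) (mat 1)"

definition sandwich ::
  "(complex^'a^'a \<Rightarrow> complex^'b^'b) \<Rightarrow> complex^'a^'a \<Rightarrow> complex^('a::finite \<times> 'b::finite)^('a \<times> 'b)" where
  "sandwich \<N> \<rho> = powA \<rho> (1/2) ** choi \<N> ** powA \<rho> (1/2)"

definition Omega1 ::
  "(complex^'a^'a \<Rightarrow> complex^'b^'b) \<Rightarrow> (complex^'a^'a \<Rightarrow> complex^'b^'b)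
     \<Rightarrow> complex^'a^'a \<Rightarrow> complex^'a^'a" where
  "Omega1 \<N>\<^sub>1 \<N>\<^sub>2 \<rho> = - ptrace_B (choi \<N>\<^sub>1 ** powA \<rho> (1/2)
     ** (log_supp (sandwich \<N>\<^sub>1 \<rho>) - log_supp (sandwich \<N>\<^sub>2 \<rho>)) ** powA \<rho> (-1/2))"

definition Omega ::
  "(complex^'a^'a \<Rightarrow> complex^'b^'b) \<Rightarrow> (complex^'a^'a \<Rightarrow> complex^'b^'b)
     \<Rightarrow> complex^'a^'a \<Rightarrow> complex^'a^'a" where
  "Omega \<N>\<^sub>1 \<N>\<^sub>2 \<rho> = (1/2) *\<^sub>R (Omega1 \<N>\<^sub>1 \<N>\<^sub>2 \<rho> + adj (Omega1 \<N>\<^sub>1 \<N>\<^sub>2 \<rho>))"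

section \<open>Gradient on the set of states\<close>

definition pd_states :: "(complex^'a^'a) set" where
  "pd_states = {\<rho>. positive_definite \<rho> \<and> trace \<rho> = 1}"

text \<open>Differentiability is relative to the trace-one Hermitian matrices, in which the positive
  definite states are open; it determines \<open>f'\<close> exactly on the traceless Hermitian directions,
  hence \<open>G\<close> up to real multiples of the identity.\<close>

definition is_gradient :: "(complex^'a^'a \<Rightarrow> real) \<Rightarrow> complex^'a^'a \<Rightarrow> complex^'a^'a \<Rightarrow> bool" where
  "is_gradient f \<rho> G \<longleftrightarrow> hermitian G \<and>
     (\<exists>f'. (f has_derivative f') (at \<rho> within pd_states) \<and>
           (\<forall>X. hermitian X \<and> trace X = 0 \<longrightarrow> complex_of_real (f' X) = trace (X ** G)))"

definition N_M :: "(complex^'a^'a) set" where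
  "N_M = {c *\<^sub>R mat 1 | c :: real. True}"

end

(*
  Write sigma and tau for the dephasing and the depolarizing sandwich of rho. For rho = (I + t sigma_z)/2,
  the derivative of f in the direction sigma_z exceeds Tr(sigma_z Omega(rho)) by the term
  Tr(sigma Dlog(tau)[dtau]). This term would vanish if sigma and tau commuted, but they do not commute
  for t > 0; at t = 1/2 it is an explicit positive number.

  The function f is differentiable there because it is elementary: write rho = a P + b Q with
  complementary rank-one projections P and Q, and identify vectors of AB with matrices. On the span of
  P and Q, tau is a 2x2 matrix; its other eigenvectors are the ranges of P (x) Q^T and Q (x) P^T.
  The operator sigma has rank two and nonzero eigenvalues depending only on the Bloch coordinate
  z = Tr(rho sigma_z). This gives f(rho) = -A(z) + B(r) + z^2 C(r), where r = a - b is the Bloch radius.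
*)

theory Submission
  imports Defs
begin

text \<open>Pairing with the traceless matrix sigma_z annihilates every c I, so one directional
  derivative refutes membership in \<open>N_M\<close>. The claim would be vacuous without a
  gradient, however, and that needs differentiability in all traceless Hermitian directions; hence
  the closed formula also covers states off the axis, and only scalar functions have to be
  differentiated. The formula rests on the identification of vectors with matrices: A (x) B acts as
  M -> A M B^T, the Choi matrix of dephasing becomes a mixture of |I><I| and |Z><Z|, and sigma a
  mixture of the unit vectors sqrt(rho) and sqrt(rho) Z. Their overlap is Tr(rho Z) = z, which is
  why the spectrum of sigma depends on z alone. C(r) contains a division by r^2 and r is not
  differentiable at the maximally mixed state, so the formula is used only where r > 0. On the axis
  sigma and tau are both 2x2 matrices on the span of P and Q; their commutator is proportional to (a
  - b) (\<beta> - (2q - 1) \<alpha>) with \<alpha> = 1 - p/2 and \<beta> = 1 - p.\<close>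

lemma matrix_add_rdistrib: "(B + C) ** A = B ** A + C ** A"
  for A :: "'a::semiring_1^'n^'m"
  by (vector matrix_matrix_mult_def sum.distrib[symmetric] field_simps)

lemma matrix_diff_ldistrib: "A ** (B - C) = A ** B - A ** C" for A :: "'a::ring_1^'n^'m"
  by (vector matrix_matrix_mult_def sum_subtractf[symmetric] field_simps)

lemma matrix_diff_rdistrib: "(B - C) ** A = B ** A - C ** A" for A :: "'a::ring_1^'n^'m"
  by (vector matrix_matrix_mult_def sum_subtractf[symmetric] field_simps)

lemma matrix_minus_left: "(- A) ** B = - (A ** B)" for A :: "'a::ring_1^'n^'m"
  by (vector matrix_matrix_mult_def sum_negf[symmetric])

lemma matrix_minus_right: "A ** (- B) = - (A ** B)" for A :: "'a::ring_1^'n^'m"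
  by (vector matrix_matrix_mult_def sum_negf[symmetric])

lemma matrix_zero_left: "(0 :: 'a::semiring_1^'n^'m) ** A = 0"
  by (vector matrix_matrix_mult_def)

lemma matrix_zero_right: "A ** (0 :: 'a::semiring_1^'n^'m) = 0"
  by (vector matrix_matrix_mult_def)

lemma matrix_scaleR_left: "(k *\<^sub>R A) ** B = k *\<^sub>R (A ** B)"
  for A :: "('a::real_algebra_1)^'m^'n"
  by (simp add: scalar_matrix_assoc)

lemma matrix_scaleR_right: "A ** (k *\<^sub>R B) = k *\<^sub>R (A ** B)"
  for A :: "('a::real_algebra_1)^'m^'n"
  by (simp add: matrix_scalar_ac scalar_matrix_assoc)

lemmas matrix_alg = matrix_add_ldistrib matrix_add_rdistrib matrix_diff_ldistrib
  matrix_diff_rdistrib matrix_minus_left matrix_minus_right matrix_zero_left matrix_zero_right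
  matrix_scaleR_left matrix_scaleR_right

lemma trace_minus: "trace (- A) = - trace A" for A :: "'a::ring_1^'n^'n"
  by (simp add: trace_def sum_negf)

lemma trace_scaleR: "trace (k *\<^sub>R A) = of_real k * trace A" for A :: "complex^'n^'n"
  by (simp add: trace_def scaleR_conv_of_real[where 'a=complex] sum_distrib_left)

lemma trace_zero: "trace (0 :: 'a::semiring_1^'n^'n) = 0"
  by (simp add: trace_def)

lemmas trace_linear = trace_add trace_sub trace_minus trace_scaleR trace_zero

lemma adj_adj [simp]: "adj (adj A) = A"
  by (simp add: adj_def vec_eq_iff)

lemma adj_mult: "adj (A ** B) = adj B ** adj A"
  by (simp add: adj_def vec_eq_iff matrix_matrix_mult_def mult.commute)

lemma adj_add: "adj (A + B) = adj A + adj B"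
  by (simp add: adj_def vec_eq_iff)

lemma adj_diff: "adj (A - B) = adj A - adj B"
  by (simp add: adj_def vec_eq_iff)

lemma adj_scaleR: "adj (k *\<^sub>R A) = k *\<^sub>R adj A"
  by (simp add: adj_def vec_eq_iff)

lemma adj_mat_1 [simp]: "adj (mat 1) = mat 1"
  by (auto simp: adj_def vec_eq_iff mat_def)

lemma trace_adj: "trace (adj A) = cnj (trace A)"
  by (simp add: trace_def adj_def)

lemma hermitian_scaleR: "hermitian A \<Longrightarrow> hermitian (k *\<^sub>R A)"
  by (simp add: hermitian_def adj_scaleR)

lemma hermitian_add: "hermitian A \<Longrightarrow> hermitian B \<Longrightarrow> hermitian (A + B)"
  by (simp add: hermitian_def adj_add)

lemma matrix_vector_scaleR: "A *v (k *\<^sub>R x) = k *\<^sub>R (A *v x)"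
  for A :: "'a::real_algebra_1^'n^'m"
  by (rule linear_cmul[OF matrix_vector_mul_linear])

section \<open>The spectral theorem\<close>

definition cinner :: "complex^'n \<Rightarrow> complex^'n \<Rightarrow> complex" where
  "cinner v w = (\<Sum>i\<in>UNIV. cnj (v $ i) * w $ i)"

lemma Re_cinner: "Re (cinner v w) = v \<bullet> w"
  by (simp add: cinner_def inner_vec_def inner_complex_def)

lemma Im_cinner: "Im (cinner v w) = (\<i> *s v) \<bullet> w"
  by (simp add: cinner_def inner_vec_def inner_complex_def algebra_simps)

lemma cinner_self: "cinner v v = of_real (v \<bullet> v)"
  by (rule complex_eqI) (simp_all add: Re_cinner,
      simp add: cinner_def algebra_simps)

lemma cinner_commute: "cinner w v = cnj (cinner v w)"
  by (simp add: cinner_def mult.commute)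

lemma cinner_scaleR_right: "cinner v (k *\<^sub>R w) = of_real k * cinner v w"
  by (simp add: cinner_def sum_distrib_left scaleR_conv_of_real[where 'a=complex] mult_ac)

lemma cinner_add_right: "cinner v (u + w) = cinner v u + cinner v w"
  by (simp add: cinner_def sum.distrib distrib_left)

lemma cinner_diff_right: "cinner v (u - w) = cinner v u - cinner v w"
  by (simp add: cinner_def sum_subtractf right_diff_distrib)

lemma cinner_hermitian:
  assumes "hermitian A"
  shows "cinner v (A *v w) = cinner (A *v v) w"
proof -
  have A: "cnj (A $ i $ j) = A $ j $ i" for i j
    using assms by (simp add: hermitian_def adj_def vec_eq_iff)
  have "cinner v (A *v w) = (\<Sum>i\<in>UNIV. \<Sum>j\<in>UNIV. cnj (v $ i) * (A $ i $ j * w $ j))"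
    by (simp add: cinner_def matrix_vector_mult_def sum_distrib_left)
  also have "\<dots> = (\<Sum>j\<in>UNIV. \<Sum>i\<in>UNIV. cnj (v $ i) * (A $ i $ j * w $ j))"
    by (rule sum.swap)
  also have "\<dots> = cinner (A *v v) w"
    by (simp add: cinner_def matrix_vector_mult_def sum_distrib_left A mult_ac)
  finally show ?thesis .
qed

lemma continuous_on_cinner_right: "continuous_on S (cinner v)"
  unfolding cinner_def by (intro continuous_intros)

text \<open>An eigenvector orthogonal to the given ones is a maximizer of the quadratic form on the unit
  sphere of their orthogonal complement, which is invariant under \<open>A\<close>.\<close>

lemma hermitian_eigenvector_orthogonal:
  fixes A :: "complex^'n^'n"
  assumes A: "hermitian A" and "finite B" and card: "card B < CARD('n)"
    and eig: "\<And>u. u \<in> B \<Longrightarrow> \<exists>l::real. A *v u = l *\<^sub>R u"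
  obtains v l where "v \<bullet> v = 1" "\<And>u. u \<in> B \<Longrightarrow> cinner u v = 0" "A *v v = (l::real) *\<^sub>R v"
proof -
  define S where "S = {w. \<forall>u\<in>B. cinner u w = 0}"
  have S: "k *\<^sub>R w \<in> S" "w + w' \<in> S" "w - w' \<in> S" if "w \<in> S" "w' \<in> S" for k w w'
    using that by (auto simp: S_def cinner_scaleR_right cinner_add_right cinner_diff_right)
  have AS: "A *v w \<in> S" if "w \<in> S" for w
    unfolding S_def
  proof (intro CollectI ballI)
    fix u assume u: "u \<in> B"
    then obtain l :: real where l: "A *v u = l *\<^sub>R u" using eig by blast
    have "cinner w u = 0" using that u cinner_commute[of w u] by (simp add: S_def)
    then have "cinner w (A *v u) = 0" by (simp add: l cinner_scaleR_right)
    then have "cinner (A *v w) u = 0" by (simp add: cinner_hermitian[OF A])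
    then show "cinner u (A *v w) = 0" using cinner_commute[of u "A *v w"] by simp
  qed
  \<comment> \<open>Real orthogonality to both u and i u is complex orthogonality to u. Adding the
    multiples i u at most doubles the number of constraints, and the real dimension is 2 CARD('n),
    so a nonzero vector remains.\<close>
  obtain x where x: "x \<noteq> 0" "x \<in> S"
  proof -
    define R where "R = B \<union> (*s) \<i> ` B"
    have "card R \<le> card B + card ((*s) \<i> ` B)"
      unfolding R_def by (rule card_Un_le)
    also have "\<dots> \<le> card B + card B"
      using card_image_le[OF \<open>finite B\<close>] by simp
    also have "\<dots> < DIM(complex^'n)"
      using card by simp
    finally have "dim R < DIM(complex^'n)"
      using dim_le_card'[of R] \<open>finite B\<close> by (simp add: R_def)
    then obtain x where x: "x \<noteq> 0" "\<And>y. y \<in> span R \<Longrightarrow> orthogonal x y"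
      using orthogonal_to_subspace_exists by metis
    have "x \<in> S"
      unfolding S_def
    proof (intro CollectI ballI complex_eqI)
      fix u assume "u \<in> B"
      then have "orthogonal x u" "orthogonal x (\<i> *s u)"
        using x(2) by (auto simp: R_def intro: span_base)
      then show "Re (cinner u x) = Re 0" "Im (cinner u x) = Im 0"
        by (simp_all add: Re_cinner Im_cinner orthogonal_def inner_commute)
    qed
    with x(1) show ?thesis by (rule that)
  qed
  define K where "K = sphere 0 1 \<inter> S"
  have "S = (\<Inter>u\<in>B. {w. cinner u w = 0})"
    by (auto simp: S_def)
  moreover have "closed {w. cinner u w = 0}" for u :: "complex^'n"
    by (intro closed_Collect_eq continuous_on_cinner_right continuous_on_const)
  ultimately have "closed S" by auto
  then have "compact K" unfolding K_def by (intro compact_Int_closed compact_sphere)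
  moreover have "(1 / norm x) *\<^sub>R x \<in> K"
    using x S by (auto simp: K_def)
  moreover have "continuous_on K (\<lambda>w. w \<bullet> (A *v w))"
    by (intro continuous_intros matrix_vector_mult_linear_continuous_on linear_continuous_on)
       (simp add: bounded_linear.linear)
  ultimately obtain v where v: "v \<in> K" "\<And>w. w \<in> K \<Longrightarrow> w \<bullet> (A *v w) \<le> v \<bullet> (A *v v)"
    using continuous_attains_sup[of K "\<lambda>w. w \<bullet> (A *v w)"] by blast
  define l where "l = v \<bullet> (A *v v)"
  \<comment> \<open>The form of M = l - A is nonnegative on S and vanishes at the maximizer v; the
    perturbation v - t u with u = M v shows that M v = 0.\<close>
  define M where "M w = l *\<^sub>R w - A *v w" for w
  have vv: "v \<bullet> v = 1" and vS: "v \<in> S"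
    using v(1) by (auto simp: K_def dot_square_norm)
  have pos: "0 \<le> w \<bullet> M w" if "w \<in> S" for w
  proof (cases "w = 0")
    case False
    then have "(1 / norm w) *\<^sub>R w \<in> K" using S that by (auto simp: K_def)
    from v(2)[OF this] have "(w \<bullet> (A *v w)) / (norm w)\<^sup>2 \<le> l"
      by (simp add: l_def matrix_vector_scaleR power2_eq_square)
    then have "w \<bullet> (A *v w) \<le> l * (w \<bullet> w)"
      using False by (simp add: divide_le_eq dot_square_norm)
    then show ?thesis by (simp add: M_def inner_diff_right)
  qed (simp add: M_def)
  define u where "u = M v"
  have uS: "u \<in> S" using S AS vS by (simp add: u_def M_def)
  have sym: "w \<bullet> (A *v w') = (A *v w) \<bullet> w'" for w w'
    using cinner_hermitian[OF A] by (metis Re_cinner)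
  have symM: "w \<bullet> M w' = M w \<bullet> w'" for w w'
    unfolding M_def inner_diff_right inner_diff_left sym[of w w'] by simp
  have "v \<bullet> M v = 0" by (simp add: M_def inner_diff_right l_def[symmetric] vv)
  then have vu: "v \<bullet> u = 0" by (simp add: u_def)
  have vMu: "v \<bullet> M u = u \<bullet> u" unfolding symM by (simp add: u_def)
  have lin: "M (v - t *\<^sub>R u) = u - t *\<^sub>R M u" for t
    unfolding u_def
    by (simp add: M_def matrix_vector_scaleR algebra_simps)
  have quad: "(v - t *\<^sub>R u) \<bullet> M (v - t *\<^sub>R u) = t\<^sup>2 * (u \<bullet> M u) - 2 * t * (u \<bullet> u)" for t
    unfolding lin
    by (simp add: vu vMu power2_eq_square algebra_simps)
  have "u \<bullet> u = 0"
  proof (rule ccontr)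
    assume "u \<bullet> u \<noteq> 0"
    then have uu: "0 < u \<bullet> u" by (simp add: order_less_le)
    \<comment> \<open>The form at v - t u is t^2 (u . M u) - 2 t (u . u), which is negative for
      small t > 0. This t is small enough; the 1 in the denominator keeps it defined when u . M u =
      0.\<close>
    define t where "t = (u \<bullet> u) / (1 + u \<bullet> M u)"
    have uM: "0 \<le> u \<bullet> M u" by (rule pos[OF uS])
    then have t: "0 < t" using uu by (simp add: t_def)
    have "0 \<le> (v - t *\<^sub>R u) \<bullet> M (v - t *\<^sub>R u)"
      using S uS vS by (intro pos) simp
    then have "2 * (u \<bullet> u) \<le> t * (u \<bullet> M u)"
      using t unfolding quad by (simp add: power2_eq_square)
    moreover have "t * (u \<bullet> M u) \<le> t * (1 + u \<bullet> M u)"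
      using t by simp
    moreover have "t * (1 + u \<bullet> M u) = u \<bullet> u"
      using uM by (simp add: t_def)
    ultimately show False using uu by simp
  qed
  then have "A *v v = l *\<^sub>R v" by (simp add: u_def M_def)
  with vv vS show ?thesis by (intro that) (auto simp: S_def)
qed

lemma hermitian_orthonormal_eigenvectors:
  fixes A :: "complex^'n^'n"
  assumes "hermitian A"
  shows "k \<le> CARD('n) \<Longrightarrow> \<exists>B. finite B \<and> card B = k \<and> (\<forall>u\<in>B. \<exists>l::real. A *v u = l *\<^sub>R u) \<and>
    (\<forall>u\<in>B. \<forall>v\<in>B. cinner u v = (if u = v then 1 else 0))"
proof (induction k)
  case 0
  show ?case by (rule exI[of _ "{}"]) simp
next
  case (Suc k)
  then obtain B where B: "finite B" "card B = k" "\<forall>u\<in>B. \<exists>l::real. A *v u = l *\<^sub>R u"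
    "\<forall>u\<in>B. \<forall>v\<in>B. cinner u v = (if u = v then 1 else 0)" by auto
  obtain v l where v: "v \<bullet> v = 1" "\<And>u. u \<in> B \<Longrightarrow> cinner u v = 0" "A *v v = (l::real) *\<^sub>R v"
    using hermitian_eigenvector_orthogonal[OF assms B(1)] B Suc.prems by auto
  have 1: "cinner v v = 1" using v(1) by (simp add: cinner_self)
  have "v \<notin> B" using 1 v(2) by force
  moreover have "cinner v u = 0" if "u \<in> B" for u
    using v(2)[OF that] by (simp add: cinner_commute[of v u])
  ultimately show ?case
    using B v 1 by (intro exI[of _ "insert v B"]) auto
qed

text \<open>Together with \<open>herm_fun_eq\<close> this makes the description in
  \<open>herm_fun\<close> definite on every Hermitian matrix.\<close>

theorem hermitian_diagonalizable:
  fixes A :: "complex^'n^'n"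
  assumes "hermitian A"
  obtains U d where "unitary U" "A = U ** real_diag d ** adj U"
proof -
  obtain B where B: "finite B" "card B = CARD('n)" "\<forall>u\<in>B. \<exists>l::real. A *v u = l *\<^sub>R u"
    "\<forall>u\<in>B. \<forall>v\<in>B. cinner u v = (if u = v then 1 else 0)"
    using hermitian_orthonormal_eigenvectors[OF assms order_refl] by auto
  obtain h :: "'n \<Rightarrow> complex^'n" where h: "bij_betw h UNIV B"
    using B finite_same_card_bij[of "UNIV :: 'n set" B] by auto
  then have hB: "h j \<in> B" for j by (auto simp: bij_betw_def)
  have "\<forall>j. \<exists>l::real. A *v h j = l *\<^sub>R h j" using B(3) hB by blast
  then obtain d :: "'n \<Rightarrow> real" where d: "\<And>j. A *v h j = d j *\<^sub>R h j"
    using choice[of "\<lambda>j l. A *v h j = l *\<^sub>R h j"] by blast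
  define U where "U = (\<chi> i j. h j $ i)"
  have "cinner (h i) (h j) = (if i = j then 1 else 0)" for i j
    using B(4) hB h by (auto simp: bij_betw_def inj_on_def)
  then have 1: "adj U ** U = mat 1"
    by (simp add: vec_eq_iff matrix_matrix_mult_def adj_def U_def mat_def cinner_def)
  then have 2: "U ** adj U = mat 1" by (simp add: matrix_left_right_inverse)
  have "A ** U = U ** real_diag d"
  proof -
    have "(A ** U) $ i $ j = (A *v h j) $ i" for i j
      by (simp add: matrix_matrix_mult_def matrix_vector_mult_def U_def)
    moreover have "(U ** real_diag d) $ i $ j = (d j *\<^sub>R h j) $ i" for i j
      by (simp add: matrix_matrix_mult_def real_diag_def U_def scaleR_conv_of_real[where 'a=complex]
          if_distrib if_distribR mult.commute cong: if_cong)
    ultimately show ?thesis by (simp add: vec_eq_iff d)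
  qed
  then have "U ** real_diag d ** adj U = A ** (U ** adj U)"
    by (simp add: matrix_mul_assoc)
  with 1 2 show ?thesis by (intro that[of U d]) (simp_all add: unitary_def)
qed

section \<open>Functional calculus computed from eigenvalue equations\<close>

lemma real_diag_mult_vec: "(real_diag d *v x) $ i = of_real (d i) * x $ i"
  by (simp add: matrix_vector_mult_def real_diag_def if_distrib if_distribR cong: if_cong)

lemma real_diag_mult_nth: "(real_diag d ** X) $ i $ j = of_real (d i) * X $ i $ j"
  by (simp add: matrix_matrix_mult_def real_diag_def if_distrib if_distribR cong: if_cong)

text \<open>In an eigenbasis, row i of \<open>adj U ** P\<close> can be nonzero only where d i = l,
  and there g (d i) = g l. The columns of P are thus arbitrary vectors of one eigenspace.\<close>

lemma herm_fun_mult_eigen: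
  fixes A :: "complex^'n^'n"
  assumes "hermitian A" and eig: "A ** P = l *\<^sub>R P"
  shows "herm_fun g A ** P = g l *\<^sub>R P"
proof -
  obtain U d where U: "unitary U" and A: "A = U ** real_diag d ** adj U"
    using hermitian_diagonalizable[OF assms(1)] .
  have UU: "adj U ** U = mat 1" "U ** adj U = mat 1" using U by (auto simp: unitary_def)
  define Q where "Q = adj U ** P"
  have P: "P = U ** Q" by (simp add: Q_def matrix_mul_assoc UU)
  have "real_diag d ** Q = adj U ** U ** real_diag d ** (adj U ** P)"
    by (simp add: UU Q_def)
  also have "\<dots> = adj U ** (A ** P)"
    by (simp only: A matrix_mul_assoc)
  also have "\<dots> = l *\<^sub>R Q"
    by (simp add: eig Q_def matrix_scaleR_right)
  finally have "(real_diag d ** Q) $ i $ j = (l *\<^sub>R Q) $ i $ j" for i j by simp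
  then have "of_real (d i) * Q $ i $ j = of_real l * Q $ i $ j" for i j
    by (simp add: real_diag_mult_nth scaleR_conv_of_real[where 'a=complex])
  then have "Q $ i $ j = 0 \<or> d i = l" for i j
    by (metis mult_cancel_right of_real_eq_iff)
  then have "of_real (g (d i)) * Q $ i $ j = of_real (g l) * Q $ i $ j" for i j
    by (metis mult_zero_right)
  then have Q: "real_diag (g \<circ> d) ** Q = g l *\<^sub>R Q"
    by (simp add: vec_eq_iff real_diag_mult_nth scaleR_conv_of_real[where 'a=complex])
  have "herm_fun g A ** P = U ** (real_diag (g \<circ> d) ** (adj U ** P))"
    unfolding A herm_fun_eq[OF U] by (simp only: matrix_mul_assoc)
  also have "\<dots> = g l *\<^sub>R P"
    unfolding Q_def[symmetric] Q by (simp add: matrix_scaleR_right flip: P)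
  finally show ?thesis .
qed

text \<open>This evaluates powers and logarithms without exhibiting a diagonalizing unitary: it
  suffices to split the identity into matrices that satisfy eigenvalue equations.\<close>

lemma herm_fun_resolution:
  fixes A :: "complex^'n^'n"
  assumes A: "hermitian A" and eig: "\<And>l P. (l, P) \<in> set xs \<Longrightarrow> A ** P = l *\<^sub>R P"
    and sum: "sum_list (map snd xs) = mat 1"
  shows "herm_fun g A = (\<Sum>(l, P)\<leftarrow>xs. g l *\<^sub>R P)"
proof -
  have "herm_fun g A ** sum_list (map snd xs) = (\<Sum>(l, P)\<leftarrow>xs. g l *\<^sub>R P)"
    using eig
  proof (induction xs)
    case (Cons x xs)
    then show ?case
      by (cases x) (simp add: matrix_add_ldistrib herm_fun_mult_eigen[OF A])
  qed (simp add: matrix_zero_right)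
  then show ?thesis by (simp add: sum)
qed

section \<open>Powers of positive definite matrices\<close>

lemma positive_definite_diagonalizable:
  fixes A :: "complex^'n^'n"
  assumes "positive_definite A"
  obtains U d where "unitary U" "A = U ** real_diag d ** adj U" "\<forall>i. 0 < d i"
proof -
  have "hermitian A" using assms by (simp add: positive_definite_def)
  then obtain U d where U: "unitary U" and A: "A = U ** real_diag d ** adj U"
    by (rule hermitian_diagonalizable)
  have UU: "adj U ** U = mat 1" using U by (simp add: unitary_def)
  have "0 < d i" for i
  proof -
    define v where "v = U *v axis i 1"
    have "adj U *v v = axis i 1"
      by (simp add: v_def matrix_vector_mul_assoc UU)
    then have "v \<noteq> 0" by (auto simp: axis_eq_0_iff)
    have "A *v v = U *v (real_diag d *v (adj U *v v))"
      by (simp add: A matrix_vector_mul_assoc matrix_mul_assoc)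
    also have "adj U *v v = axis i 1" by fact
    also have "real_diag d *v axis i 1 = d i *\<^sub>R axis i 1"
      by (simp add: vec_eq_iff real_diag_mult_vec axis_def scaleR_conv_of_real[where 'a=complex])
    finally have Av: "A *v v = d i *\<^sub>R v" by (simp add: matrix_vector_scaleR v_def)
    have "0 < Re (cinner v (A *v v))"
      using assms \<open>v \<noteq> 0\<close> by (auto simp: positive_definite_def cinner_def)
    then have "0 < d i * (v \<bullet> v)"
      by (simp add: Av cinner_scaleR_right Re_cinner)
    then show ?thesis
      by (simp add: zero_less_mult_iff) (use inner_ge_zero[of v] in linarith)
  qed
  with U A show ?thesis using that by blast
qed

lemma real_diag_mult: "real_diag d ** real_diag e = real_diag (\<lambda>i. d i * e i)"
  by (simp add: vec_eq_iff real_diag_mult_nth) (simp add: real_diag_def)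

lemma adj_real_diag [simp]: "adj (real_diag d) = real_diag d"
  by (auto simp: vec_eq_iff real_diag_def adj_def)

lemma herm_powr_add:
  assumes "positive_definite A"
  shows "herm_powr A s ** herm_powr A t = herm_powr A (s + t)"
proof -
  obtain U d where U: "unitary U" and A: "A = U ** real_diag d ** adj U" and d: "\<forall>i. 0 < d i"
    by (rule positive_definite_diagonalizable[OF assms])
  have UU: "adj U ** U = mat 1" using U by (simp add: unitary_def)
  have "herm_powr A s = U ** real_diag (\<lambda>i. d i powr s) ** adj U" for s
    by (simp add: herm_powr_def A herm_fun_eq[OF U] o_def)
  moreover have "U ** D ** adj U ** (U ** E ** adj U) = U ** (D ** E) ** adj U" for D E
  proof -
    have "U ** D ** adj U ** (U ** E ** adj U) = U ** (D ** (adj U ** U) ** E) ** adj U"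
      by (simp only: matrix_mul_assoc)
    then show ?thesis by (simp add: UU)
  qed
  ultimately show ?thesis by (simp add: real_diag_mult powr_add)
qed

lemma herm_powr_one:
  assumes "positive_definite A"
  shows "herm_powr A 1 = A"
proof -
  obtain U d where U: "unitary U" and A: "A = U ** real_diag d ** adj U" and d: "\<forall>i. 0 < d i"
    by (rule positive_definite_diagonalizable[OF assms])
  show ?thesis using d by (simp add: less_imp_le herm_powr_def A herm_fun_eq[OF U] o_def)
qed

lemma hermitian_herm_powr:
  assumes "positive_definite A"
  shows "hermitian (herm_powr A s)"
proof -
  obtain U d where U: "unitary U" and A: "A = U ** real_diag d ** adj U" and d: "\<forall>i. 0 < d i"
    by (rule positive_definite_diagonalizable[OF assms])
  show ?thesis
    by (simp add: herm_powr_def A herm_fun_eq[OF U] hermitian_def adj_mult matrix_mul_assoc)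
qed

section \<open>Operators on a tensor product\<close>

lemma sum_UNIV_prod: "(\<Sum>x\<in>UNIV. f x) = (\<Sum>i\<in>UNIV. \<Sum>j\<in>UNIV. f (i, j))"
  for f :: "'a::finite \<times> 'b::finite \<Rightarrow> 'c::comm_monoid_add"
  by (simp add: sum.cartesian_product)

lemma tensor_mult: "tensor A B ** tensor C D = tensor (A ** C) (B ** D)"
  by (simp add: vec_eq_iff tensor_def matrix_matrix_mult_def sum_UNIV_prod sum_product mult_ac)

lemma tensor_one: "tensor (mat 1) (mat 1) = mat 1"
  by (auto simp: vec_eq_iff tensor_def mat_def prod_eq_iff)

lemma adj_tensor: "adj (tensor A B) = tensor (adj A) (adj B)"
  by (simp add: vec_eq_iff tensor_def adj_def)

lemma tensor_add_left: "tensor (A + A') B = tensor A B + tensor A' B"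
  by (simp add: vec_eq_iff tensor_def distrib_right)

lemma tensor_scaleR_left: "tensor (k *\<^sub>R A) B = k *\<^sub>R tensor A B"
  by (simp add: vec_eq_iff tensor_def)

lemma tensor_add_right: "tensor A (B + B') = tensor A B + tensor A B'"
  by (simp add: vec_eq_iff tensor_def distrib_left)

text \<open>The partial trace is dual to A -> A (x) I. This moves traces against
  \<open>Omega1\<close> to the bipartite space, where cyclicity applies.\<close>

lemma trace_mult_ptrace_B: "trace (A ** ptrace_B M) = trace (tensor A (mat 1) ** M)"
proof -
  have "trace (tensor A (mat 1) ** M) =
    (\<Sum>i\<in>UNIV. \<Sum>k\<in>UNIV. \<Sum>j\<in>UNIV. A $ i $ j * M $ (j, k) $ (i, k))"
  proof -
    have "x * (if b then 1 else 0) * y = (if b then x * y else 0)" for x y :: complex and b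
      by simp
    then show ?thesis
      by (simp add: trace_def tensor_def matrix_matrix_mult_def sum_UNIV_prod mat_def)
  qed
  also have "\<dots> = (\<Sum>i\<in>UNIV. \<Sum>j\<in>UNIV. \<Sum>k\<in>UNIV. A $ i $ j * M $ (j, k) $ (i, k))"
    by (intro sum.cong refl sum.swap)
  also have "\<dots> = trace (A ** ptrace_B M)"
    by (simp add: trace_def ptrace_B_def matrix_matrix_mult_def sum_distrib_left)
  finally show ?thesis by simp
qed

text \<open>Vectors of \<open>AB\<close> are identified with matrices; \<open>ketbra M N\<close> is the operator \<open>|M\<rangle>\<langle>N|\<close>, and
  the inner product is \<open>\<langle>M, N\<rangle> = trace (adj M ** N)\<close>.\<close>

definition ketbra ::
  "complex^'b^'a \<Rightarrow> complex^'b^'a \<Rightarrow> complex^('a::finite \<times> 'b::finite)^('a \<times> 'b)" where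
  "ketbra M N = (\<chi> r c. M $ fst r $ snd r * cnj (N $ fst c $ snd c))"

lemma adj_ketbra: "adj (ketbra M N) = ketbra N M"
  by (simp add: vec_eq_iff ketbra_def adj_def mult.commute)

lemma trace_ketbra: "trace (ketbra M N) = trace (adj N ** M)"
proof -
  have "trace (ketbra M N) = (\<Sum>i\<in>UNIV. \<Sum>j\<in>UNIV. cnj (N $ i $ j) * M $ i $ j)"
    by (simp add: trace_def ketbra_def sum_UNIV_prod mult.commute)
  also have "\<dots> = trace (adj N ** M)"
    by (subst sum.swap) (simp add: trace_def matrix_matrix_mult_def adj_def)
  finally show ?thesis .
qed

text \<open>The inner products that occur below are real, so products of ketbras stay within real
  linear combinations.\<close>

lemma ketbra_mult:
  assumes "trace (adj N ** M') = of_real c"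
  shows "ketbra M N ** ketbra M' N' = c *\<^sub>R ketbra M N'"
proof -
  have c: "(\<Sum>k\<in>UNIV. \<Sum>l\<in>UNIV. cnj (N $ k $ l) * M' $ k $ l) = of_real c"
    using assms trace_ketbra[of M' N] by (simp add: trace_def ketbra_def sum_UNIV_prod mult.commute)
  have "(ketbra M N ** ketbra M' N') $ r $ s = (c *\<^sub>R ketbra M N') $ r $ s" for r s
  proof -
    have "(ketbra M N ** ketbra M' N') $ r $ s =
      (\<Sum>k\<in>UNIV. \<Sum>l\<in>UNIV. cnj (N $ k $ l) * M' $ k $ l) * (M $ fst r $ snd r * cnj (N' $ fst s $ snd s))"
      by (simp add: ketbra_def matrix_matrix_mult_def sum_UNIV_prod sum_distrib_left mult_ac)
    then show ?thesis by (simp add: c ketbra_def scaleR_conv_of_real[where 'a=complex])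
  qed
  then show ?thesis by (simp add: vec_eq_iff)
qed

text \<open>A (x) B acts on a vector M of AB as M -> A M B^T; the transposes on B in later formulas
  originate here.\<close>

lemma tensor_ketbra: "tensor A B ** ketbra M N = ketbra (A ** M ** transpose B) N"
proof -
  have "(tensor A B ** ketbra M N) $ r $ s = ketbra (A ** M ** transpose B) N $ r $ s" for r s
  proof -
    have "(tensor A B ** ketbra M N) $ r $ s = 
      (\<Sum>l\<in>UNIV. (\<Sum>k\<in>UNIV. A $ fst r $ k * M $ k $ l) * B $ snd r $ l) * cnj (N $ fst s $ snd s)"
      unfolding sum_distrib_right
      by (subst sum.swap)
        (simp add: ketbra_def tensor_def matrix_matrix_mult_def sum_UNIV_prod mult_ac)
    then show ?thesis by (simp add: ketbra_def matrix_matrix_mult_def transpose_def)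
  qed
  then show ?thesis by (simp add: vec_eq_iff)
qed

lemma ketbra_tensor:
  "ketbra M N ** tensor A B = ketbra M (adj A ** N ** transpose (adj B))"
proof -
  have "adj (adj (tensor A B) ** ketbra N M) = ketbra M (adj A ** N ** transpose (adj B))"
    by (simp add: adj_tensor tensor_ketbra adj_ketbra)
  then show ?thesis by (simp add: adj_mult adj_ketbra)
qed

lemma ketbra_add_left: "ketbra (M + M') N = ketbra M N + ketbra M' N"
  by (simp add: vec_eq_iff ketbra_def distrib_right)

lemma ketbra_add_right: "ketbra M (N + N') = ketbra M N + ketbra M N'"
  by (simp add: vec_eq_iff ketbra_def distrib_left)

lemma ketbra_diff_left: "ketbra (M - M') N = ketbra M N - ketbra M' N"
  by (simp add: vec_eq_iff ketbra_def left_diff_distrib)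

lemma ketbra_diff_right: "ketbra M (N - N') = ketbra M N - ketbra M N'"
  by (simp add: vec_eq_iff ketbra_def right_diff_distrib)

lemma ketbra_scaleR_left: "ketbra (k *\<^sub>R M) N = k *\<^sub>R ketbra M N"
  by (simp add: vec_eq_iff ketbra_def)

lemma ketbra_scaleR_right: "ketbra M (k *\<^sub>R N) = k *\<^sub>R ketbra M N"
  by (simp add: vec_eq_iff ketbra_def)

lemmas ketbra_bilinear = ketbra_add_left ketbra_add_right ketbra_diff_left ketbra_diff_right
  ketbra_scaleR_left ketbra_scaleR_right

lemma hermitian_ketbra: "hermitian (ketbra M M)"
  by (simp add: hermitian_def adj_ketbra)

lemma transpose_mat_1: "transpose (mat 1) = (mat 1 :: 'a::semiring_1^'n^'n)"
  by (auto simp: vec_eq_iff transpose_def mat_def)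

section \<open>The trace identity\<close>

text \<open>Cyclicity brings \<rho>^(-1/2) next to X, and the relation with Y trades it for
  \<rho>^(1/2), which completes the sandwich of the first channel. The Hermitian part in
  \<open>Omega\<close> becomes the real part. The lemma is applied with X = \<rho>, Y = I, which
  gives f = Tr[\<rho> Omega], and with X = sigma_z, Y = sigma_z \<rho>^(-1).\<close>

lemma trace_mult_Omega:
  assumes pd: "positive_definite \<rho>" and X: "hermitian X"
    and Y: "herm_powr \<rho> (-1/2) ** X = Y ** herm_powr \<rho> (1/2)"
  shows "trace (X ** Omega \<N>\<^sub>1 \<N>\<^sub>2 \<rho>) = of_real (- Re (trace (tensor Y (mat 1) **
    (sandwich \<N>\<^sub>1 \<rho> ** (log_supp (sandwich \<N>\<^sub>1 \<rho>) - log_supp (sandwich \<N>\<^sub>2 \<rho>))))))"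
proof -
  define L where "L = log_supp (sandwich \<N>\<^sub>1 \<rho>) - log_supp (sandwich \<N>\<^sub>2 \<rho>)"
  define T where "T = trace (tensor Y (mat 1) ** (sandwich \<N>\<^sub>1 \<rho> ** L))"
  have pow: "powA \<rho> (-1/2) ** tensor X (mat 1) = tensor Y (mat 1) ** powA \<rho> (1/2)"
    unfolding powA_def tensor_mult Y by simp
  have "trace (X ** Omega1 \<N>\<^sub>1 \<N>\<^sub>2 \<rho>)
      = - trace (tensor X (mat 1) ** (choi \<N>\<^sub>1 ** powA \<rho> (1/2) ** L ** powA \<rho> (-1/2)))"
    by (simp add: Omega1_def matrix_minus_right trace_minus trace_mult_ptrace_B L_def)
  also have "\<dots> = - trace (choi \<N>\<^sub>1 ** powA \<rho> (1/2) ** L ** (powA \<rho> (-1/2) ** tensor X (mat 1)))"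
    by (subst trace_mul_sym) (simp add: matrix_mul_assoc)
  also have "\<dots> = - T"
    unfolding pow T_def sandwich_def by (subst trace_mul_sym) (simp add: matrix_mul_assoc)
  finally have 1: "trace (X ** Omega1 \<N>\<^sub>1 \<N>\<^sub>2 \<rho>) = - T" .
  have "trace (X ** adj (Omega1 \<N>\<^sub>1 \<N>\<^sub>2 \<rho>)) = cnj (trace (Omega1 \<N>\<^sub>1 \<N>\<^sub>2 \<rho> ** X))"
    using X by (simp add: adj_mult hermitian_def flip: trace_adj)
  also have "\<dots> = - cnj T" by (subst trace_mul_sym) (simp add: 1)
  finally have 2: "trace (X ** adj (Omega1 \<N>\<^sub>1 \<N>\<^sub>2 \<rho>)) = - cnj T" .
  have "trace (X ** Omega \<N>\<^sub>1 \<N>\<^sub>2 \<rho>) = of_real (1/2) * (- T - cnj T)"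
    by (simp add: Omega_def matrix_scaleR_right trace_scaleR matrix_add_ldistrib trace_add 1 2)
  then show ?thesis
    by (simp add: T_def L_def complex_eq_iff)
qed

lemma trace_Omega:
  assumes "positive_definite \<rho>"
  shows "trace (\<rho> ** Omega \<N>\<^sub>1 \<N>\<^sub>2 \<rho>)
    = of_real (- rel_entropy (sandwich \<N>\<^sub>1 \<rho>) (sandwich \<N>\<^sub>2 \<rho>))"
proof -
  have "herm_powr \<rho> (-1/2) ** \<rho> = mat 1 ** herm_powr \<rho> (1/2)"
    using herm_powr_add[OF assms, of "-1/2" 1] by (simp add: herm_powr_one[OF assms])
  moreover have "hermitian \<rho>" using assms by (simp add: positive_definite_def)
  ultimately show ?thesis
    using trace_mult_Omega[OF assms, of \<rho> "mat 1"] by (simp add: rel_entropy_def tensor_one)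
qed

section \<open>The two channels\<close>

lemma choi_nth: "choi \<N> $ (i, k) $ (j, l) = \<N> (mat_unit i j) $ k $ l"
proof -
  have "choi \<N> $ (i, k) $ (j, l) =
    (\<Sum>x\<in>UNIV. \<Sum>y\<in>UNIV. if i = x then if j = y then \<N> (mat_unit x y) $ k $ l else 0 else 0)"
    unfolding choi_def
    by (simp add: tensor_def) (intro sum.cong refl, simp add: mat_unit_def)
  also have "\<dots> = (\<Sum>x\<in>UNIV. if i = x then \<N> (mat_unit x j) $ k $ l else 0)"
    by (intro sum.cong refl) simp
  finally show ?thesis by simp
qed

lemma pauli_z_nth:
  "pauli_z $ 1 $ 1 = 1" "pauli_z $ 1 $ 2 = 0" "pauli_z $ 2 $ 1 = 0" "pauli_z $ 2 $ 2 = -1"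
  by (simp_all add: pauli_z_def)

lemma hermitian_pauli_z: "hermitian pauli_z"
  by (simp add: hermitian_def adj_def vec_eq_iff forall_2 pauli_z_nth)

lemma pauli_z_square: "pauli_z ** pauli_z = mat 1"
  by (simp add: vec_eq_iff forall_2 matrix_matrix_mult_def sum_2 pauli_z_nth mat_def)

text \<open>The two vectors are the Kraus operators I and sigma_z of the channel, read as vectors of
  AB.\<close>

lemma choi_dephasing:
  "choi (dephasing q) = q *\<^sub>R ketbra (mat 1) (mat 1) + (1 - q) *\<^sub>R ketbra pauli_z pauli_z"
  by (simp add: vec_eq_iff split_paired_all forall_2 choi_nth dephasing_def ketbra_def mat_def
      mat_unit_def matrix_matrix_mult_def sum_2 pauli_z_nth)

lemma choi_depolarizing:
  "choi (depolarizing p) = (1 - p) *\<^sub>R ketbra (mat 1) (mat 1) + (p / 2) *\<^sub>R mat 1"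
  by (simp add: vec_eq_iff split_paired_all forall_2 choi_nth depolarizing_def ketbra_def mat_def
      mat_unit_def trace_def sum_2 scaleR_conv_of_real[where 'a=complex])

lemma sandwich_dephasing:
  assumes "positive_definite \<rho>"
  shows "sandwich (dephasing q) \<rho> = q *\<^sub>R ketbra (herm_powr \<rho> (1/2)) (herm_powr \<rho> (1/2))
    + (1 - q) *\<^sub>R ketbra (herm_powr \<rho> (1/2) ** pauli_z) (herm_powr \<rho> (1/2) ** pauli_z)"
  using hermitian_herm_powr[OF assms, of "1/2"]
  by (simp add: sandwich_def choi_dephasing powA_def matrix_alg tensor_ketbra ketbra_tensor
      transpose_mat_1 hermitian_def)

lemma sandwich_depolarizing:
  assumes "positive_definite \<rho>"
  shows "sandwich (depolarizing p) \<rho> = (1 - p) *\<^sub>R ketbra (herm_powr \<rho> (1/2)) (herm_powr \<rho> (1/2))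
    + (p / 2) *\<^sub>R tensor \<rho> (mat 1)"
  using hermitian_herm_powr[OF assms, of "1/2"] herm_powr_add[OF assms, of "1/2" "1/2"]
  by (simp add: sandwich_def choi_depolarizing powA_def matrix_alg tensor_ketbra ketbra_tensor
      transpose_mat_1 hermitian_def tensor_mult herm_powr_one[OF assms])

section \<open>Operators of rank two\<close>

text \<open>A 2x2 coefficient matrix with respect to the vectors M and N. It is used for the
  orthonormal pair P, Q and for the pair R, S, whose overlap is in general nonzero.\<close>

definition blk where
  "blk M N x11 x12 x21 x22 =
    x11 *\<^sub>R ketbra M M + x12 *\<^sub>R ketbra M N + x21 *\<^sub>R ketbra N M + x22 *\<^sub>R ketbra N N"

lemma blk_add: "blk M N x11 x12 x21 x22 + blk M N y11 y12 y21 y22 =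
    blk M N (x11 + y11) (x12 + y12) (x21 + y21) (x22 + y22)"
  by (simp add: blk_def scaleR_add_left)

lemma blk_diff: "blk M N x11 x12 x21 x22 - blk M N y11 y12 y21 y22 =
    blk M N (x11 - y11) (x12 - y12) (x21 - y21) (x22 - y22)"
  by (simp add: blk_def scaleR_diff_left)

lemma blk_scaleR: "k *\<^sub>R blk M N x11 x12 x21 x22 = blk M N (k * x11) (k * x12) (k * x21) (k * x22)"
  by (simp add: blk_def scaleR_add_right)

text \<open>Coefficient matrices multiply as X G Y, where G is the Gram matrix with diagonal 1 and
  off-diagonal entry c.\<close>

lemma blk_mult:
  assumes "trace (adj M ** M) = 1" "trace (adj N ** N) = 1" "trace (adj M ** N) = of_real c"
  shows "blk M N x11 x12 x21 x22 ** blk M N y11 y12 y21 y22 =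
    blk M N (x11 * (y11 + c * y21) + x12 * (c * y11 + y21))
            (x11 * (y12 + c * y22) + x12 * (c * y12 + y22))
            (x21 * (y11 + c * y21) + x22 * (c * y11 + y21))
            (x21 * (y12 + c * y22) + x22 * (c * y12 + y22))"
proof -
  have "trace (adj N ** M) = cnj (trace (adj M ** N))"
    by (simp add: adj_mult flip: trace_adj)
  then have NM: "trace (adj N ** M) = of_real c" using assms by simp
  have 1: "trace (adj M ** M) = of_real 1" "trace (adj N ** N) = of_real 1" using assms by auto
  note r = ketbra_mult[OF 1(1)] ketbra_mult[OF 1(2)] ketbra_mult[OF assms(3)] ketbra_mult[OF NM]
  show ?thesis
    by (simp add: blk_def matrix_alg r algebra_simps)
qed

lemma trace_blk:
  assumes "trace (adj M ** M) = 1" "trace (adj N ** N) = 1" "trace (adj M ** N) = of_real c"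
  shows "trace (blk M N x11 x12 x21 x22) = of_real (x11 + c * x12 + c * x21 + x22)"
proof -
  have "trace (adj N ** M) = cnj (trace (adj M ** N))"
    by (simp add: adj_mult flip: trace_adj)
  then show ?thesis
    using assms by (simp add: blk_def trace_linear trace_ketbra)
qed

lemma trace_ketbra_blk:
  assumes "trace (adj S ** M) = of_real u" "trace (adj S ** N) = of_real v"
  shows "trace (ketbra S S ** blk M N x11 x12 x21 x22) =
    of_real (x11 * u\<^sup>2 + (x12 + x21) * (u * v) + x22 * v\<^sup>2)"
proof -
  have "trace (adj M ** S) = cnj (trace (adj S ** M))" "trace (adj N ** S) = cnj (trace (adj S ** N))"
    by (simp_all add: adj_mult flip: trace_adj)
  then have "trace (ketbra S M) = of_real u" "trace (ketbra S N) = of_real v"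
    using assms by (simp_all add: trace_ketbra)
  then show ?thesis
    by (simp add: blk_def matrix_alg trace_linear ketbra_mult[OF assms(1)] ketbra_mult[OF assms(2)]
        power2_eq_square algebra_simps)
qed

lemma trace_ketbra_tensor: "trace (ketbra S S ** tensor A B) = trace (adj S ** A ** S ** transpose B)"
  by (subst trace_mul_sym) (simp add: tensor_ketbra trace_ketbra matrix_mul_assoc)

text \<open>By the cubic equation the spectrum lies in {0, l1, l2}. The polynomial on the right
  vanishes at 0 and agrees with x ln x at l1 and l2. The spectral parts \<open>P1\<close> and
  \<open>P2\<close> are the Lagrange interpolation polynomials in A for l1 and l2; the remainder
  \<open>mat 1 - P1 - P2\<close> belongs to the eigenvalue 0, where \<open>log_supp\<close> takes
  the value 0.\<close>

lemma log_supp_rank_two: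
  fixes A :: "complex^'n^'n"
  assumes A: "hermitian A" and l: "0 < l1" "0 < l2" "l1 \<noteq> l2"
    and cubic: "A ** (A ** A) = (l1 + l2) *\<^sub>R (A ** A) - (l1 * l2) *\<^sub>R A"
  shows "A ** log_supp A =
    ((ln l1 - ln l2) / (l1 - l2)) *\<^sub>R (A ** A) + ((l1 * ln l2 - l2 * ln l1) / (l1 - l2)) *\<^sub>R A"
proof -
  define k where "k = 1 / (l1 - l2)"
  have k: "k * (l1 - l2) = 1" using l by (simp add: k_def)
  define P1 where "P1 = (k / l1) *\<^sub>R (A ** A - l2 *\<^sub>R A)"
  define P2 where "P2 = (k / l2) *\<^sub>R (l1 *\<^sub>R A - A ** A)"
  have 1: "A ** P1 = l1 *\<^sub>R P1"
    by (simp add: P1_def matrix_alg cubic algebra_simps)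
  have 2: "A ** P2 = l2 *\<^sub>R P2"
    by (simp add: P2_def matrix_alg cubic algebra_simps)
  have P: "l1 *\<^sub>R P1 = k *\<^sub>R (A ** A - l2 *\<^sub>R A)" "l2 *\<^sub>R P2 = k *\<^sub>R (l1 *\<^sub>R A - A ** A)"
    using l by (simp_all add: P1_def P2_def)
  have "l1 *\<^sub>R P1 + l2 *\<^sub>R P2 = (k * (l1 - l2)) *\<^sub>R A"
    unfolding P by (simp add: algebra_simps)
  then have "l1 *\<^sub>R P1 + l2 *\<^sub>R P2 = A" by (simp add: k)
  then have 0: "A ** (mat 1 - P1 - P2) = 0 *\<^sub>R (mat 1 - P1 - P2)"
    by (simp add: matrix_alg 1 2 diff_diff_eq)
  have "log_supp A = ln l1 *\<^sub>R P1 + ln l2 *\<^sub>R P2"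
    unfolding log_supp_def
    by (subst herm_fun_resolution[OF A, of "[(l1, P1), (l2, P2), (0, mat 1 - P1 - P2)]"])
       (use 0 1 2 l in auto)
  then have "A ** log_supp A = ln l1 *\<^sub>R (l1 *\<^sub>R P1) + ln l2 *\<^sub>R (l2 *\<^sub>R P2)"
    by (simp add: matrix_alg 1 2)
  also have "\<dots> = (k * (ln l1 - ln l2)) *\<^sub>R (A ** A) + (k * (l1 * ln l2 - l2 * ln l1)) *\<^sub>R A"
    unfolding P by (simp add: algebra_simps)
  finally show ?thesis by (simp add: k_def)
qed

section \<open>Rank-one projections in dimension two\<close>

locale qubit_projection =
  fixes P :: "complex^2^2"
  assumes herm: "hermitian P" and idem: "P ** P = P" and tr: "trace P = 1"
begin

text \<open>All 2x2 minors vanish because P has rank one. With trace 1, the (1,1) entry of P P = P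
  is exactly the equation det P = 0.\<close>

lemma minor: "P $ i $ j * P $ k $ l = P $ i $ l * P $ k $ j"
proof -
  have t: "P $ 2 $ 2 = 1 - P $ 1 $ 1"
    using tr by (simp add: trace_def sum_2 algebra_simps)
  have "P $ 1 $ 1 * P $ 1 $ 1 + P $ 1 $ 2 * P $ 2 $ 1 = P $ 1 $ 1"
    using idem by (simp add: vec_eq_iff forall_2 matrix_matrix_mult_def sum_2)
  then have "P $ 1 $ 2 * P $ 2 $ 1 = P $ 1 $ 1 * P $ 2 $ 2"
    unfolding t by (simp add: algebra_simps)
  moreover have "i = 1 \<or> i = 2" "j = 1 \<or> j = 2" "k = 1 \<or> k = 2" "l = 1 \<or> l = 2"
    by (simp_all add: exhaust_2)
  ultimately show ?thesis by (auto simp: mult.commute)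
qed

lemma cnj_nth: "cnj (P $ i $ j) = P $ j $ i"
  using herm by (simp add: hermitian_def adj_def vec_eq_iff)

text \<open>For P = |u><u| the vector of AB that corresponds to P is u (x) conj u, and the transpose
  of P projects onto conj u.\<close>

lemma tensor_transpose: "tensor P (transpose P) = ketbra P P"
proof -
  have "P $ i $ j * P $ l $ k = P $ i $ k * P $ l $ j" for i j k l
    by (rule minor)
  then show ?thesis
    by (simp add: vec_eq_iff tensor_def ketbra_def cnj_nth transpose_def split_paired_all)
qed

lemma sandwich_nth: "(P ** X ** P) $ i $ j = trace (X ** P) * P $ i $ j"
proof -
  have m: "P $ i $ k * X $ k $ l * P $ l $ j = X $ k $ l * P $ l $ k * P $ i $ j" for k l
    using minor[of i k l j] by (simp add: mult_ac)
  show ?thesis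
    by (simp add: matrix_matrix_mult_def sum_2 trace_def distrib_right m)
qed

lemma trace_sandwich: "trace (P ** X ** P ** Y) = trace (X ** P) * trace (P ** Y)"
proof -
  have "(P ** X ** P ** Y) $ i $ i = trace (X ** P) * (P ** Y) $ i $ i" for i
    by (simp add: matrix_matrix_mult_def[of _ Y] sandwich_nth sum_distrib_left mult.assoc)
  then show ?thesis by (simp add: trace_def sum_distrib_left)
qed

lemma complement: "qubit_projection (mat 1 - P)"
proof
  show "hermitian (mat 1 - P)" using herm by (simp add: hermitian_def adj_diff)
  show "(mat 1 - P) ** (mat 1 - P) = mat 1 - P" by (simp add: matrix_alg idem)
  show "trace (mat 1 - P) = 1" by (simp add: trace_sub tr trace_I)
qed

end

section \<open>Qubit states through their spectral decomposition\<close>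

locale qubit_state = qubit_projection +
  fixes a b :: real and \<rho> :: "complex^2^2"
  assumes ab: "0 < a" "0 < b" "a + b = 1"
    and rho: "\<rho> = a *\<^sub>R P + b *\<^sub>R (mat 1 - P)"
    and pd: "positive_definite \<rho>"
begin

abbreviation "Q \<equiv> mat 1 - P"

sublocale Q: qubit_projection Q
  by (rule complement)

text \<open>The z coordinate of the unit Bloch vector of P; the z coordinate of \<rho> is therefore
  (a - b) w.\<close>

definition w where "w = Re (trace (pauli_z ** P))"

lemma PQ: "P ** P = P" "P ** Q = 0" "Q ** P = 0" "Q ** Q = Q"
  using idem Q.idem by (simp_all add: matrix_alg)

lemma adj_P: "adj P = P" "adj Q = Q"
  using herm Q.herm by (simp_all add: hermitian_def)

lemma trace_PQ: "trace (adj P ** P) = 1" "trace (adj Q ** Q) = 1" "trace (adj P ** Q) = of_real 0"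
  "trace (adj Q ** P) = of_real 0"
  unfolding adj_P PQ by (simp_all add: tr Q.tr trace_zero)

lemmas blk_PQ_mult = blk_mult[OF trace_PQ(1-3), simplified]
lemmas trace_blk_PQ = trace_blk[OF trace_PQ(1-3), simplified]

lemma herm_powr_rho: "herm_powr \<rho> s = (a powr s) *\<^sub>R P + (b powr s) *\<^sub>R Q"
  using pd unfolding herm_powr_def
  by (subst herm_fun_resolution[of _ "[(a, P), (b, Q)]"])
     (auto simp: positive_definite_def rho matrix_add_rdistrib matrix_scaleR_left PQ)

definition R where "R = sqrt a *\<^sub>R P + sqrt b *\<^sub>R Q"

lemma herm_powr_half: "herm_powr \<rho> (1/2) = R"
  using ab by (simp add: herm_powr_rho R_def powr_half_sqrt)

lemma trace_Z: "trace (pauli_z ** P) = of_real w" "trace (pauli_z ** Q) = of_real (- w)"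
proof -
  have "cnj (trace (pauli_z ** P)) = trace (pauli_z ** P)"
    using herm hermitian_pauli_z
    by (subst trace_mul_sym) (simp add: hermitian_def adj_mult flip: trace_adj)
  then show 1: "trace (pauli_z ** P) = of_real w"
    unfolding w_def by (metis Reals_cnj_iff of_real_Re)
  have "trace pauli_z = 0" by (simp add: trace_def sum_2 pauli_z_nth)
  then show "trace (pauli_z ** Q) = of_real (- w)"
    by (simp add: matrix_diff_ldistrib trace_sub 1)
qed

lemma adj_R: "adj R = R"
  by (simp add: R_def adj_add adj_scaleR adj_P)

lemma R_mult: "R ** P = sqrt a *\<^sub>R P" "R ** Q = sqrt b *\<^sub>R Q" "P ** R = sqrt a *\<^sub>R P" "Q ** R = sqrt b *\<^sub>R Q"
  by (simp_all add: R_def matrix_add_rdistrib matrix_add_ldistrib matrix_scaleR_left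
      matrix_scaleR_right PQ)

lemma R_square: "R ** R = \<rho>"
  using ab by (subst (2) R_def)
    (simp add: matrix_add_ldistrib matrix_scaleR_right R_mult rho)

text \<open>R and S are the square root of \<rho> times the Kraus operators I and sigma_z, hence the
  two vectors that span the range of the dephasing sandwich.\<close>

definition S where "S = R ** pauli_z"

lemma adj_S: "adj S = pauli_z ** R"
  using hermitian_pauli_z by (simp add: S_def adj_mult adj_R hermitian_def)

lemma trace_rho: "trace \<rho> = 1"
  using ab by (simp add: rho trace_add trace_scaleR tr Q.tr flip: of_real_add)

text \<open>The overlap equals Tr(sigma_z \<rho>), so the Gram matrix of R and S sees only the z
  coordinate of the state.\<close>

lemma trace_RS: "trace (adj R ** R) = 1" "trace (adj S ** S) = 1"
  "trace (adj R ** S) = of_real ((a - b) * w)"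
proof -
  show "trace (adj R ** R) = 1" by (simp add: adj_R R_square trace_rho)
  have "trace (adj S ** S) = trace (R ** pauli_z ** (pauli_z ** R))"
    unfolding adj_S by (subst trace_mul_sym) (simp add: S_def)
  also have "R ** pauli_z ** (pauli_z ** R) = R ** (pauli_z ** pauli_z) ** R"
    by (simp only: matrix_mul_assoc)
  finally show "trace (adj S ** S) = 1" by (simp add: pauli_z_square R_square trace_rho)
  have "trace (adj R ** S) = trace (pauli_z ** \<rho>)"
    unfolding S_def adj_R matrix_mul_assoc R_square by (rule trace_mul_sym)
  also have "\<dots> = of_real ((a - b) * w)"
    by (simp add: rho matrix_add_ldistrib matrix_scaleR_right trace_add trace_scaleR trace_Z
        left_diff_distrib)
  finally show "trace (adj R ** S) = of_real ((a - b) * w)" .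
qed

lemma trace_R_PQ: "trace (adj R ** P) = of_real (sqrt a)" "trace (adj R ** Q) = of_real (sqrt b)"
  by (simp_all add: adj_R R_mult trace_scaleR tr Q.tr)

lemma trace_S_PQ: "trace (adj S ** P) = of_real (sqrt a * w)"
  "trace (adj S ** Q) = of_real (- (sqrt b * w))"
  by (simp_all add: adj_S R_mult trace_scaleR matrix_scaleR_right trace_Z flip: matrix_mul_assoc)

lemma trace_R_off:
  "trace (ketbra R R ** tensor P (transpose Q)) = 0"
  "trace (ketbra R R ** tensor Q (transpose P)) = 0"
  by (simp_all add: trace_ketbra_tensor adj_R R_mult trace_scaleR matrix_scaleR_left
      matrix_scaleR_right PQ trace_zero flip: matrix_mul_assoc)

text \<open>R commutes with P and Q, so the weights reduce to a and b times Tr(Z P Z Q) = Tr(Z P Z)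
  - Tr(Z P Z P) = 1 - w^2, where Z is sigma_z and P Z P = w P.\<close>

lemma trace_S_off:
  "trace (ketbra S S ** tensor P (transpose Q)) = of_real (a * (1 - w\<^sup>2))"
  "trace (ketbra S S ** tensor Q (transpose P)) = of_real (b * (1 - w\<^sup>2))"
proof -
  have sym: "trace (pauli_z ** Q ** pauli_z ** P) = trace (pauli_z ** P ** pauli_z ** Q)"
    using trace_mul_sym[of "pauli_z ** Q" "pauli_z ** P"] by (simp add: matrix_mul_assoc)
  have "trace (pauli_z ** P ** pauli_z) = trace (pauli_z ** pauli_z ** P)"
    by (subst trace_mul_sym) (simp add: matrix_mul_assoc)
  moreover have "trace (pauli_z ** P ** pauli_z ** P) = trace (P ** pauli_z ** P ** pauli_z)"
    using trace_mul_sym[of "pauli_z ** P ** pauli_z" P] by (simp add: matrix_mul_assoc)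
  moreover have "trace (P ** pauli_z) = of_real w"
    using trace_Z(1) by (subst trace_mul_sym)
  ultimately have 1: "trace (pauli_z ** P ** pauli_z ** Q) = of_real (1 - w\<^sup>2)"
    by (simp add: matrix_diff_ldistrib trace_sub pauli_z_square tr trace_sandwich trace_Z
        power2_eq_square)
  have "pauli_z ** R ** P ** (R ** pauli_z) ** Q = pauli_z ** (R ** P ** R) ** pauli_z ** Q"
    "pauli_z ** R ** Q ** (R ** pauli_z) ** P = pauli_z ** (R ** Q ** R) ** pauli_z ** P"
    by (simp_all only: matrix_mul_assoc)
  moreover have "R ** P ** R = a *\<^sub>R P" "R ** Q ** R = b *\<^sub>R Q"
    using ab by (simp_all add: R_mult matrix_scaleR_left)
  ultimately show "trace (ketbra S S ** tensor P (transpose Q)) = of_real (a * (1 - w\<^sup>2))"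
    "trace (ketbra S S ** tensor Q (transpose P)) = of_real (b * (1 - w\<^sup>2))"
    unfolding trace_ketbra_tensor adj_S transpose_transpose unfolding S_def
    by (simp_all only: matrix_scaleR_left matrix_scaleR_right trace_scaleR sym 1 of_real_mult)
qed

text \<open>Since det P = 0, the number P11 (1 - P11) = |P21|^2 is nonnegative, and 1 - w^2 is four
  times it. The bound keeps z = r w inside the unit interval.\<close>

lemma w_square_le_1: "w\<^sup>2 \<le> 1"
proof -
  have P22: "P $ 2 $ 2 = 1 - P $ 1 $ 1"
    using tr by (simp add: trace_def sum_2 algebra_simps)
  have real: "Im (P $ 1 $ 1) = 0"
    using cnj_nth[of 1 1] by (simp add: complex_eq_iff)
  have "P $ 1 $ 1 * P $ 2 $ 2 = cnj (P $ 2 $ 1) * P $ 2 $ 1"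
    unfolding cnj_nth by (rule minor)
  then have "Re (P $ 1 $ 1) * (1 - Re (P $ 1 $ 1)) = (Re (P $ 2 $ 1))\<^sup>2 + (Im (P $ 2 $ 1))\<^sup>2"
    using real by (simp add: P22 complex_eq_iff power2_eq_square)
  then have nonneg: "0 \<le> Re (P $ 1 $ 1) * (1 - Re (P $ 1 $ 1))" by simp
  have w: "w = 2 * Re (P $ 1 $ 1) - 1"
    by (simp add: w_def trace_def sum_2 matrix_matrix_mult_def pauli_z_nth P22)
  have "w\<^sup>2 = 1 - 4 * (Re (P $ 1 $ 1) * (1 - Re (P $ 1 $ 1)))"
    unfolding w by (simp add: power2_eq_square algebra_simps)
  with nonneg show ?thesis by simp
qed

end

section \<open>Spectra and logarithms of the two sandwiched Choi matrices\<close>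

lemma blk_cong: "x11 = y11 \<Longrightarrow> x12 = y12 \<Longrightarrow> x21 = y21 \<Longrightarrow> x22 = y22 \<Longrightarrow>
    blk M N x11 x12 x21 x22 = blk M N y11 y12 y21 y22"
  by simp

locale qubit_channels = qubit_state +
  fixes p q :: real
  assumes p: "0 < p" "p < 1" and q: "0 < q" "q < 1"
begin

abbreviation "\<sigma> \<equiv> sandwich (dephasing q) \<rho>"
abbreviation "\<tau> \<equiv> sandwich (depolarizing p) \<rho>"
abbreviation "\<alpha> \<equiv> 1 - p / 2"
abbreviation "\<beta> \<equiv> 1 - p"

lemma sigma_eq: "\<sigma> = blk R S q 0 0 (1 - q)"
  using sandwich_dephasing[OF pd] by (simp add: blk_def herm_powr_half S_def)

text \<open>On vectors read as matrices, \<open>off\<close> is M -> P M Q and \<open>off'\<close> is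
  M -> Q M P. With the projections onto P and Q themselves they split M into its four blocks, which
  is the content of \<open>resolution\<close>.\<close>

definition off :: "complex^(2\<times>2)^(2\<times>2)" where "off = tensor P (transpose Q)"
definition off' :: "complex^(2\<times>2)^(2\<times>2)" where "off' = tensor Q (transpose P)"

lemma transpose_PQ: "transpose P ** transpose Q = 0" "transpose Q ** transpose P = 0"
  "transpose Q ** transpose Q = transpose Q" "transpose P ** transpose P = transpose P"
proof -
  have "transpose 0 = (0 :: complex^2^2)" by (simp add: vec_eq_iff transpose_def)
  then show "transpose P ** transpose Q = 0" "transpose Q ** transpose P = 0"
    "transpose Q ** transpose Q = transpose Q" "transpose P ** transpose P = transpose P"
    by (simp_all add: PQ flip: matrix_transpose_mul)
qed

lemma ketbra_zero: "ketbra 0 N = 0" "ketbra M 0 = 0" "tensor 0 X = 0" "tensor X 0 = 0"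
  by (simp_all add: vec_eq_iff ketbra_def tensor_def)

lemma transpose_adj_transpose: "transpose (adj (transpose X)) = adj X"
  by (simp add: vec_eq_iff transpose_def adj_def)

lemma off_mult: "off ** off = off" "off' ** off' = off'" "off ** off' = 0" "off' ** off = 0"
  "off ** blk P Q x11 x12 x21 x22 = 0" "off' ** blk P Q x11 x12 x21 x22 = 0"
  "blk P Q x11 x12 x21 x22 ** off = 0" "blk P Q x11 x12 x21 x22 ** off' = 0"
  by (simp_all add: off_def off'_def tensor_mult PQ transpose_PQ ketbra_zero blk_def matrix_alg
      tensor_ketbra ketbra_tensor adj_P transpose_adj_transpose)

lemma resolution: "blk P Q 1 0 0 1 + off + off' = mat 1"
proof -
  have "transpose P + transpose Q = mat 1"
    by (simp add: vec_eq_iff transpose_def mat_def)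
  then have "tensor (P + Q) (transpose P + transpose Q) = mat 1"
    by (simp add: tensor_one)
  moreover have "tensor (P + Q) (transpose P + transpose Q) = blk P Q 1 0 0 1 + off + off'"
    unfolding tensor_add_left tensor_add_right tensor_transpose Q.tensor_transpose
    by (simp add: blk_def off_def off'_def)
  ultimately show ?thesis by simp
qed

definition s where "s = sqrt a * sqrt b"

lemma s_square: "s * s = a * b"
  using ab by (simp add: s_def flip: real_sqrt_mult)

text \<open>The operator \<rho> (x) I is diagonal in the four blocks, with eigenvalues a and b,
  while |R><R| acts only on the span of P and Q, with coefficients a, s, s, b. The diagonal entries
  combine through \<alpha> = \<beta> + p/2.\<close>

lemma tau_eq: "\<tau> = blk P Q (\<alpha> * a) (\<beta> * s) (\<beta> * s) (\<alpha> * b) + (p / 2 * a) *\<^sub>R off + (p / 2 * b) *\<^sub>R off'"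
proof -
  have 1: "ketbra R R = blk P Q a s s b"
    using ab by (simp add: R_def ketbra_add_left ketbra_add_right ketbra_scaleR_left
        ketbra_scaleR_right blk_def s_def scaleR_add_right mult.commute)
  have "tensor \<rho> (mat 1) = (a *\<^sub>R tensor P (mat 1) + b *\<^sub>R tensor Q (mat 1))"
    by (simp add: rho tensor_add_left tensor_scaleR_left)
  also have "tensor P (mat 1) = tensor P (mat 1) ** mat 1" by simp
  also have "\<dots> = blk P Q 1 0 0 0 + off"
    by (simp add: blk_def off_def off'_def matrix_alg tensor_ketbra tensor_mult PQ
        transpose_mat_1 ketbra_zero flip: resolution)
  also have "tensor Q (mat 1) = tensor Q (mat 1) ** mat 1" by simp
  also have "\<dots> = blk P Q 0 0 0 1 + off'"
    by (simp add: blk_def off_def off'_def matrix_alg tensor_ketbra tensor_mult PQ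
        transpose_mat_1 ketbra_zero flip: resolution)
  finally have 2: "tensor \<rho> (mat 1) = blk P Q a 0 0 b + a *\<^sub>R off + b *\<^sub>R off'"
    by (simp add: blk_def algebra_simps)
  have "\<tau> = \<beta> *\<^sub>R blk P Q a s s b + (p / 2) *\<^sub>R (blk P Q a 0 0 b + a *\<^sub>R off + b *\<^sub>R off')"
    using sandwich_depolarizing[OF pd] by (simp add: herm_powr_half 1 2)
  also have "\<dots> = (\<beta> *\<^sub>R blk P Q a s s b + (p / 2) *\<^sub>R blk P Q a 0 0 b)
    + (p / 2 * a) *\<^sub>R off + (p / 2 * b) *\<^sub>R off'"
    by (simp add: scaleR_add_right)
  also have "\<beta> *\<^sub>R blk P Q a s s b + (p / 2) *\<^sub>R blk P Q a 0 0 b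
    = blk P Q (\<alpha> * a) (\<beta> * s) (\<beta> * s) (\<alpha> * b)"
    unfolding blk_scaleR blk_add by (rule blk_cong) (simp_all add: algebra_simps)
  finally show ?thesis .
qed

lemma sigma_herm: "hermitian \<sigma>" and tau_herm: "hermitian \<tau>"
proof -
  show "hermitian \<sigma>"
    unfolding sigma_eq blk_def by (simp add: hermitian_add hermitian_scaleR hermitian_ketbra)
  have "hermitian (tensor \<rho> (mat 1 :: complex^2^2))"
    using pd by (simp add: positive_definite_def hermitian_def adj_tensor)
  then show "hermitian \<tau>"
    unfolding sandwich_depolarizing[OF pd]
    by (simp add: hermitian_add hermitian_scaleR hermitian_ketbra)
qed

text \<open>On the span of R and S the operator is represented by diag(q, 1 - q) times the Gram
  matrix, of trace 1 and determinant q (1 - q) (1 - ((a - b) w)^2). Cayley-Hamilton, multiplied once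
  more by \<sigma>, is the required cubic equation.\<close>

lemma sigma_log_sigma:
  assumes l: "0 < l1" "0 < l2" "l1 \<noteq> l2" "l1 + l2 = 1"
    and prod: "l1 * l2 = q * (1 - q) * (1 - ((a - b) * w)\<^sup>2)"
  shows "\<sigma> ** log_supp \<sigma> =
    ((ln l1 - ln l2) / (l1 - l2)) *\<^sub>R (\<sigma> ** \<sigma>) + ((l1 * ln l2 - l2 * ln l1) / (l1 - l2)) *\<^sub>R \<sigma>"
proof (rule log_supp_rank_two[OF sigma_herm l(1-3)])
  define c where "c = (a - b) * w"
  have m: "blk R S x11 x12 x21 x22 ** blk R S y11 y12 y21 y22 =
    blk R S (x11 * (y11 + c * y21) + x12 * (c * y11 + y21))
            (x11 * (y12 + c * y22) + x12 * (c * y12 + y22))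
            (x21 * (y11 + c * y21) + x22 * (c * y11 + y21))
            (x21 * (y12 + c * y22) + x22 * (c * y12 + y22))" for x11 x12 x21 x22 y11 y12 y21 y22
    unfolding c_def by (rule blk_mult[OF trace_RS])
  show "\<sigma> ** (\<sigma> ** \<sigma>) = (l1 + l2) *\<^sub>R (\<sigma> ** \<sigma>) - (l1 * l2) *\<^sub>R \<sigma>"
    unfolding sigma_eq m blk_scaleR blk_diff prod l(4) c_def[symmetric]
    by (rule blk_cong) (simp_all add: power2_eq_square algebra_simps)
qed

lemma trace_sigma: "trace \<sigma> = 1"
  "trace (\<sigma> ** \<sigma>) = of_real (1 - 2 * (q * (1 - q) * (1 - ((a - b) * w)\<^sup>2)))"
  unfolding sigma_eq blk_mult[OF trace_RS] trace_blk[OF trace_RS]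
  by (simp_all add: power2_eq_square algebra_simps flip: of_real_mult of_real_add of_real_diff)

lemma trace_sigma_log_sigma:
  assumes l: "0 < l1" "0 < l2" "l1 \<noteq> l2" "l1 + l2 = 1"
    and prod: "l1 * l2 = q * (1 - q) * (1 - ((a - b) * w)\<^sup>2)"
  shows "trace (\<sigma> ** log_supp \<sigma>) = of_real (l1 * ln l1 + l2 * ln l2)"
proof -
  have l2: "l2 = 1 - l1" using l by simp
  have "trace (\<sigma> ** log_supp \<sigma>) = of_real ((ln l1 - ln l2) / (l1 - l2) * (1 - 2 * (l1 * l2))
      + (l1 * ln l2 - l2 * ln l1) / (l1 - l2))"
    unfolding sigma_log_sigma[OF assms] trace_add trace_scaleR trace_sigma prod[symmetric]
    by simp
  also have "(ln l1 - ln l2) / (l1 - l2) * (1 - 2 * (l1 * l2)) + (l1 * ln l2 - l2 * ln l1) / (l1 - l2)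
    = ((ln l1 - ln l2) * (1 - 2 * (l1 * l2)) + (l1 * ln l2 - l2 * ln l1)) / (l1 - l2)"
    by (simp add: add_divide_distrib)
  also have "\<dots> = (l1 * ln l1 + l2 * ln l2) * (l1 - l2) / (l1 - l2)"
    unfolding l2 by (simp add: algebra_simps)
  also have "\<dots> = l1 * ln l1 + l2 * ln l2" using l by simp
  finally show ?thesis .
qed

text \<open>The block of \<tau> on the span of P and Q has trace \<alpha> and determinant a b
  (\<alpha>^2 - \<beta>^2), so m1 and m2 are its eigenvalues. There the logarithm is the linear
  interpolation c0 + c1 x evaluated at the block; \<open>off\<close> and \<open>off'\<close> carry
  the eigenvalues p a / 2 and p b / 2.\<close>

lemma log_supp_tau:
  assumes m: "0 < m1" "0 < m2" "m1 \<noteq> m2" "m1 + m2 = \<alpha>"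
    and prod: "m1 * m2 = a * b * (\<alpha>\<^sup>2 - \<beta>\<^sup>2)"
    and c0: "c0 = (m1 * ln m2 - m2 * ln m1) / (m1 - m2)" and c1: "c1 = (ln m1 - ln m2) / (m1 - m2)"
  shows "log_supp \<tau> = blk P Q (c0 + c1 * \<alpha> * a) (c1 * \<beta> * s) (c1 * \<beta> * s) (c0 + c1 * \<alpha> * b)
    + ln (p / 2 * a) *\<^sub>R off + ln (p / 2 * b) *\<^sub>R off'"
proof -
  define B where "B = blk P Q (\<alpha> * a) (\<beta> * s) (\<beta> * s) (\<alpha> * b)"
  define E where "E = blk P Q 1 0 0 1"
  define k where "k = 1 / (m1 - m2)"
  have k: "k * (m1 - m2) = 1" using m by (simp add: k_def)
  define P1 where "P1 = k *\<^sub>R (B - m2 *\<^sub>R E)"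
  define P2 where "P2 = k *\<^sub>R (m1 *\<^sub>R E - B)"
  have tau: "\<tau> = B + (p / 2 * a) *\<^sub>R off + (p / 2 * b) *\<^sub>R off'"
    unfolding B_def by (rule tau_eq)
  have "B ** B = blk P Q (\<alpha> * (\<alpha> * a) - a * b * (\<alpha>\<^sup>2 - \<beta>\<^sup>2)) (\<alpha> * (\<beta> * s))
      (\<alpha> * (\<beta> * s)) (\<alpha> * (\<alpha> * b) - a * b * (\<alpha>\<^sup>2 - \<beta>\<^sup>2))"
  proof -
    have sq: "a * a = a * (a + b) - a * b" "b * b = b * (a + b) - a * b"
      by (simp_all add: algebra_simps)
    \<comment> \<open>Variables in place of \<alpha> and \<beta> keep these from being expanded in
      p; the identities depend only on s^2 = a b and a + b = 1.\<close>
    have "x * a * (x * a) + y * s * (y * s) = x * (x * a) - a * b * (x\<^sup>2 - y\<^sup>2)"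
      "x * a * (y * s) + y * s * (x * b) = x * (y * s)"
      "y * s * (x * a) + x * b * (y * s) = x * (y * s)"
      "y * s * (y * s) + x * b * (x * b) = x * (x * b) - a * b * (x\<^sup>2 - y\<^sup>2)" for x y
    proof -
      have "x * a * (x * a) + y * s * (y * s) = x\<^sup>2 * (a * a) + y\<^sup>2 * (s * s)"
        by (simp add: power2_eq_square)
      then show "x * a * (x * a) + y * s * (y * s) = x * (x * a) - a * b * (x\<^sup>2 - y\<^sup>2)"
        unfolding s_square sq ab(3) by (simp add: power2_eq_square algebra_simps)
      have "y * s * (y * s) + x * b * (x * b) = x\<^sup>2 * (b * b) + y\<^sup>2 * (s * s)"
        by (simp add: power2_eq_square)
      then show "y * s * (y * s) + x * b * (x * b) = x * (x * b) - a * b * (x\<^sup>2 - y\<^sup>2)"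
        unfolding s_square sq ab(3) by (simp add: power2_eq_square algebra_simps)
      have "x * a * (y * s) + y * s * (x * b) = x * (y * s) * (a + b)"
        by (simp add: algebra_simps)
      then show "x * a * (y * s) + y * s * (x * b) = x * (y * s)" unfolding ab(3) by simp
      then show "y * s * (x * a) + x * b * (y * s) = x * (y * s)" by (simp add: mult_ac)
    qed
    from this[where x = \<alpha> and y = \<beta>] show ?thesis
      unfolding B_def blk_PQ_mult by (intro blk_cong)
  qed
  then have BB: "B ** B = \<alpha> *\<^sub>R B - (m1 * m2) *\<^sub>R E"
    unfolding prod by (simp add: B_def E_def blk_scaleR blk_diff)
  have BE: "B ** E = B" by (simp add: B_def E_def blk_PQ_mult)
  have off: "off ** B = 0" "off' ** B = 0" "off ** E = 0" "off' ** E = 0" "B ** off = 0" "B ** off' = 0"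
    by (simp_all add: B_def E_def off_mult)
  have tB: "\<tau> ** B = (m1 + m2) *\<^sub>R B - (m1 * m2) *\<^sub>R E" and tE: "\<tau> ** E = B"
    unfolding tau m(4) by (simp_all add: matrix_alg off BB BE)
  have 1: "\<tau> ** P1 = m1 *\<^sub>R P1" and 2: "\<tau> ** P2 = m2 *\<^sub>R P2"
    unfolding P1_def P2_def matrix_scaleR_right matrix_diff_ldistrib tB tE
    by (simp_all add: algebra_simps)
  have 3: "\<tau> ** off = (p / 2 * a) *\<^sub>R off" and 4: "\<tau> ** off' = (p / 2 * b) *\<^sub>R off'"
    unfolding tau by (simp_all add: matrix_alg off off_mult)
  have "P1 + P2 = (k * (m1 - m2)) *\<^sub>R E" by (simp add: P1_def P2_def algebra_simps)
  then have sum: "P1 + P2 + off + off' = mat 1" using resolution by (simp add: k E_def)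
  have "log_supp \<tau> = ln m1 *\<^sub>R P1 + ln m2 *\<^sub>R P2 + ln (p / 2 * a) *\<^sub>R off + ln (p / 2 * b) *\<^sub>R off'"
    unfolding log_supp_def
    by (subst herm_fun_resolution[OF tau_herm,
          of "[(m1, P1), (m2, P2), (p / 2 * a, off), (p / 2 * b, off')]"])
       (use 1 2 3 4 sum m ab p in \<open>auto simp: add.assoc\<close>)
  also have "ln m1 *\<^sub>R P1 + ln m2 *\<^sub>R P2 = c1 *\<^sub>R B + c0 *\<^sub>R E"
  proof -
    have c: "c0 = k * (m1 * ln m2 - m2 * ln m1)" "c1 = k * (ln m1 - ln m2)"
      by (simp_all add: c0 c1 k_def)
    show ?thesis unfolding c P1_def P2_def by (simp add: algebra_simps)
  qed
  also have "c1 *\<^sub>R B + c0 *\<^sub>R E =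
      blk P Q (c0 + c1 * \<alpha> * a) (c1 * \<beta> * s) (c1 * \<beta> * s) (c0 + c1 * \<alpha> * b)"
    unfolding B_def E_def blk_scaleR blk_add by (rule blk_cong) simp_all
  finally show ?thesis .
qed

text \<open>R lies in the span of P and Q. S has weight w^2 there, with the relative sign of its P
  and Q components reversed, and the remaining weight 1 - w^2 is divided between \<open>off\<close>
  and \<open>off'\<close> in the ratio a to b. The reversed sign turns + 2 \<beta> a b into - 2
  \<beta> a b.\<close>

lemma trace_sigma_log_tau:
  assumes m: "0 < m1" "0 < m2" "m1 \<noteq> m2" "m1 + m2 = \<alpha>"
    and prod: "m1 * m2 = a * b * (\<alpha>\<^sup>2 - \<beta>\<^sup>2)"
    and c0: "c0 = (m1 * ln m2 - m2 * ln m1) / (m1 - m2)" and c1: "c1 = (ln m1 - ln m2) / (m1 - m2)"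
  shows "trace (\<sigma> ** log_supp \<tau>) = of_real (q * (c0 + c1 * (\<alpha> * (a\<^sup>2 + b\<^sup>2) + 2 * \<beta> * (a * b)))
    + (1 - q) * (w\<^sup>2 * (c0 + c1 * (\<alpha> * (a\<^sup>2 + b\<^sup>2) - 2 * \<beta> * (a * b)))
      + (1 - w\<^sup>2) * (a * ln (p / 2 * a) + b * ln (p / 2 * b))))"
proof -
  let ?X = "blk P Q (c0 + c1 * \<alpha> * a) (c1 * \<beta> * s) (c1 * \<beta> * s) (c0 + c1 * \<alpha> * b)"
  have sq: "(sqrt a)\<^sup>2 = a" "(sqrt b)\<^sup>2 = b" "sqrt a * sqrt b = s" using ab by (simp_all add: s_def)
  have c0: "c0 = a * c0 + b * c0" using ab by (simp flip: distrib_right)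
  have "trace (ketbra R R ** ?X) = of_real ((c0 + c1 * \<alpha> * a) * a + 2 * (c1 * \<beta> * s) * s + (c0 + c1 * \<alpha> * b) * b)"
    unfolding trace_ketbra_blk[OF trace_R_PQ] sq by simp
  also have "(c0 + c1 * \<alpha> * a) * a + 2 * (c1 * \<beta> * s) * s + (c0 + c1 * \<alpha> * b) * b
    = (a * c0 + b * c0) + c1 * (\<alpha> * (a\<^sup>2 + b\<^sup>2)) + c1 * (2 * \<beta> * (s * s))"
    by (simp add: power2_eq_square algebra_simps)
  also have "\<dots> = c0 + c1 * (\<alpha> * (a\<^sup>2 + b\<^sup>2) + 2 * \<beta> * (a * b))"
    unfolding c0[symmetric] s_square by (simp add: algebra_simps)
  finally have 1: "trace (ketbra R R ** ?X) = of_real (c0 + c1 * (\<alpha> * (a\<^sup>2 + b\<^sup>2) + 2 * \<beta> * (a * b)))" .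
  have "trace (ketbra S S ** ?X) = of_real ((c0 + c1 * \<alpha> * a) * (a * w\<^sup>2)
      + 2 * (c1 * \<beta> * s) * (- (s * w\<^sup>2)) + (c0 + c1 * \<alpha> * b) * (b * w\<^sup>2))"
    unfolding trace_ketbra_blk[OF trace_S_PQ] power2_minus power_mult_distrib sq
    by (simp add: power2_eq_square sq(3)[symmetric] mult_ac)
  also have "(c0 + c1 * \<alpha> * a) * (a * w\<^sup>2)
      + 2 * (c1 * \<beta> * s) * (- (s * w\<^sup>2)) + (c0 + c1 * \<alpha> * b) * (b * w\<^sup>2)
    = w\<^sup>2 * ((a * c0 + b * c0) + c1 * (\<alpha> * (a\<^sup>2 + b\<^sup>2)) - c1 * (2 * \<beta> * (s * s)))"
    by (simp add: power2_eq_square algebra_simps)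
  also have "\<dots> = w\<^sup>2 * (c0 + c1 * (\<alpha> * (a\<^sup>2 + b\<^sup>2) - 2 * \<beta> * (a * b)))"
    unfolding c0[symmetric] s_square by (simp add: algebra_simps)
  finally have 2: "trace (ketbra S S ** ?X)
    = of_real (w\<^sup>2 * (c0 + c1 * (\<alpha> * (a\<^sup>2 + b\<^sup>2) - 2 * \<beta> * (a * b))))" .
  have "trace (\<sigma> ** log_supp \<tau>) = of_real q * trace (ketbra R R ** log_supp \<tau>)
      + of_real (1 - q) * trace (ketbra S S ** log_supp \<tau>)"
    unfolding sigma_eq blk_def by (simp add: matrix_alg trace_linear)
  also have "trace (ketbra R R ** log_supp \<tau>) = trace (ketbra R R ** ?X)"
    unfolding log_supp_tau[OF assms]
    by (simp add: matrix_alg trace_linear off_def off'_def trace_R_off)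
  also have "trace (ketbra S S ** log_supp \<tau>) = trace (ketbra S S ** ?X)
      + of_real (ln (p / 2 * a) * (a * (1 - w\<^sup>2)) + ln (p / 2 * b) * (b * (1 - w\<^sup>2)))"
    unfolding log_supp_tau[OF assms]
    by (simp add: matrix_alg trace_linear off_def off'_def trace_S_off)
  finally show ?thesis
    unfolding 1 2 by (simp add: algebra_simps)
qed

end

section \<open>The objective function\<close>

text \<open>The discriminant functions are the eigenvalue gaps for p = 1/20, q = 2/5. For \<sigma>
  the eigenvalues are the roots of x^2 - x + 6/25 (1 - z^2), as q (1 - q) = 6/25. For the block of
  \<tau>, with \<alpha> = 39/40, \<beta> = 19/20 and a b = (1 - r^2)/4, they are the roots of x^2 -
  39/40 x + 77/6400 (1 - r^2), as \<alpha>^2 - \<beta>^2 = 77/1600.\<close>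

definition disc_sigma :: "real \<Rightarrow> real" where
  "disc_sigma z = sqrt (1 - 24/25 * (1 - z\<^sup>2))"
definition eig_sigma :: "real \<Rightarrow> real" where
  "eig_sigma z = (1 + disc_sigma z) / 2"
definition eig_sigma' :: "real \<Rightarrow> real" where
  "eig_sigma' z = (1 - disc_sigma z) / 2"
definition disc_tau :: "real \<Rightarrow> real" where
  "disc_tau r = sqrt (361/400 + 77/1600 * r\<^sup>2)"
definition eig_tau :: "real \<Rightarrow> real" where
  "eig_tau r = (39/40 + disc_tau r) / 2"
definition eig_tau' :: "real \<Rightarrow> real" where
  "eig_tau' r = (39/40 - disc_tau r) / 2"

lemmas eig_defs = eig_sigma_def eig_sigma'_def eig_tau_def eig_tau'_def

lemma disc_sigma_bounds:
  assumes "z\<^sup>2 < 1" shows "0 < disc_sigma z" "disc_sigma z < 1"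
    "(disc_sigma z)\<^sup>2 = 1 - 24/25 * (1 - z\<^sup>2)"
proof -
  have "0 < 1/25 + 24/25 * z\<^sup>2" by (intro add_pos_nonneg) simp_all
  also have "\<dots> = 1 - 24/25 * (1 - z\<^sup>2)" by (simp add: field_simps)
  finally have "0 < 1 - 24/25 * (1 - z\<^sup>2)" .
  then show "0 < disc_sigma z" "(disc_sigma z)\<^sup>2 = 1 - 24/25 * (1 - z\<^sup>2)"
    by (simp_all add: disc_sigma_def)
  show "disc_sigma z < 1" using assms by (simp add: disc_sigma_def)
qed

lemma disc_tau_bounds:
  assumes "r\<^sup>2 < 1" shows "0 < disc_tau r" "disc_tau r < 39/40"
    "(disc_tau r)\<^sup>2 = 361/400 + 77/1600 * r\<^sup>2"
proof -
  have "0 < 361/400 + 77/1600 * r\<^sup>2" by (intro add_pos_nonneg) simp_all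
  then show "0 < disc_tau r" "(disc_tau r)\<^sup>2 = 361/400 + 77/1600 * r\<^sup>2"
    by (simp_all add: disc_tau_def)
  show "disc_tau r < 39/40" unfolding disc_tau_def
    by (rule real_less_lsqrt) (use assms in \<open>auto simp: power2_eq_square\<close>)
qed

lemma eig_sigma:
  assumes "z\<^sup>2 < 1"
  shows "0 < eig_sigma z" "0 < eig_sigma' z" "eig_sigma z \<noteq> eig_sigma' z"
    "eig_sigma z + eig_sigma' z = 1" "eig_sigma z * eig_sigma' z = 6/25 * (1 - z\<^sup>2)"
proof -
  have "eig_sigma z * eig_sigma' z = (1 - (disc_sigma z)\<^sup>2) / 4"
    by (simp add: eig_defs power2_eq_square algebra_simps)
  then show "eig_sigma z * eig_sigma' z = 6/25 * (1 - z\<^sup>2)"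
    using disc_sigma_bounds[OF assms] by (simp add: algebra_simps)
qed (use disc_sigma_bounds[OF assms] in \<open>auto simp: eig_defs field_simps\<close>)

lemma eig_tau:
  assumes "r\<^sup>2 < 1"
  shows "0 < eig_tau r" "0 < eig_tau' r" "eig_tau r \<noteq> eig_tau' r"
    "eig_tau r + eig_tau' r = 39/40" "eig_tau r * eig_tau' r = 77/6400 * (1 - r\<^sup>2)"
proof -
  have "eig_tau r * eig_tau' r = ((39/40)\<^sup>2 - (disc_tau r)\<^sup>2) / 4"
    by (simp add: eig_defs power2_eq_square algebra_simps)
  then show "eig_tau r * eig_tau' r = 77/6400 * (1 - r\<^sup>2)"
    using disc_tau_bounds[OF assms] by (simp add: algebra_simps power2_eq_square)
qed (use disc_tau_bounds[OF assms] in \<open>auto simp: eig_defs field_simps\<close>)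

text \<open>On the span of \<open>P\<close> and \<open>Q\<close>, the logarithm of \<open>\<tau>\<close> is \<open>log_const r\<close> times the identity plus
  \<open>log_slope r\<close> times \<open>\<tau>\<close>.\<close>

definition log_slope :: "real \<Rightarrow> real" where
  "log_slope r = (ln (eig_tau r) - ln (eig_tau' r)) / (eig_tau r - eig_tau' r)"
definition log_const :: "real \<Rightarrow> real" where
  "log_const r = (eig_tau r * ln (eig_tau' r) - eig_tau' r * ln (eig_tau r)) / (eig_tau r - eig_tau' r)"

definition entropy_part :: "real \<Rightarrow> real" where
  "entropy_part z = eig_sigma z * ln (eig_sigma z) + eig_sigma' z * ln (eig_sigma' z)"
text \<open>Expectations of the logarithm of \<tau>: \<open>log_plus\<close> in the vector sqrt(a) P
  + sqrt(b) Q, \<open>log_minus\<close> in sqrt(a) P - sqrt(b) Q, and \<open>log_off\<close> over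
  the two off-diagonal blocks with weights a and b.\<close>

definition log_plus :: "real \<Rightarrow> real" where
  "log_plus r = log_const r + log_slope r * (39/80 * (1 + r\<^sup>2) + 19/40 * (1 - r\<^sup>2))"
definition log_minus :: "real \<Rightarrow> real" where
  "log_minus r = log_const r + log_slope r * (39/80 * (1 + r\<^sup>2) - 19/40 * (1 - r\<^sup>2))"
definition log_off :: "real \<Rightarrow> real" where
  "log_off r = (1 + r) / 2 * ln (1/40 * ((1 + r) / 2)) + (1 - r) / 2 * ln (1/40 * ((1 - r) / 2))"
definition coeff0 :: "real \<Rightarrow> real" where
  "coeff0 r = 2/5 * log_plus r + 3/5 * log_off r"
text \<open>Division by r^2 replaces w^2 by (r w)^2, the square of the z coordinate, which is a
  smooth function of the state.\<close>

definition coeff2 :: "real \<Rightarrow> real" where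
  "coeff2 r = 3/5 * (log_minus r - log_off r) / r\<^sup>2"

definition objective :: "complex^2^2 \<Rightarrow> real" where
  "objective \<rho> = - rel_entropy (sandwich (dephasing (2/5)) \<rho>) (sandwich (depolarizing (1/20)) \<rho>)"

lemma (in qubit_state) objective_eq:
  assumes r: "a = (1 + r) / 2" "b = (1 - r) / 2" "r \<noteq> 0"
  shows "objective \<rho> = - entropy_part (r * w) + coeff0 r + (r * w)\<^sup>2 * coeff2 r"
proof -
  interpret qubit_channels P a b \<rho> "1/20" "2/5"
    by unfold_locales auto
  have r1: "\<bar>r\<bar> < 1" using ab r by (auto simp: abs_if)
  then have r2: "r\<^sup>2 < 1" by (simp add: abs_square_less_1)
  have abr: "a - b = r" by (simp add: r field_simps)
  have "(r * w)\<^sup>2 \<le> r\<^sup>2"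
    using w_square_le_1 mult_left_mono[of "w\<^sup>2" 1 "r\<^sup>2"] by (simp add: power_mult_distrib)
  then have rw: "(r * w)\<^sup>2 < 1" using r2 by linarith
  note s = eig_sigma[OF rw] and t = eig_tau[OF r2]
  have 1: "trace (\<sigma> ** log_supp \<sigma>) = of_real (entropy_part (r * w))"
    unfolding entropy_part_def
    by (rule trace_sigma_log_sigma) (use s abr in auto)
  have ab': "a * b = (1 - r\<^sup>2) / 4" "a\<^sup>2 + b\<^sup>2 = (1 + r\<^sup>2) / 2"
    by (simp_all add: r power2_eq_square field_simps)
  have 2: "trace (\<sigma> ** log_supp \<tau>) = of_real (2/5 * log_plus r
    + (1 - 2/5) * (w\<^sup>2 * log_minus r + (1 - w\<^sup>2) * log_off r))"
  proof -
    have l: "log_plus r = log_const r + log_slope r * (\<alpha> * (a\<^sup>2 + b\<^sup>2) + 2 * \<beta> * (a * b))"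
      "log_minus r = log_const r + log_slope r * (\<alpha> * (a\<^sup>2 + b\<^sup>2) - 2 * \<beta> * (a * b))"
      "log_off r = a * ln (1/20 / 2 * a) + b * ln (1/20 / 2 * b)"
      unfolding log_plus_def log_minus_def ab' by (simp_all add: log_off_def r)
    have "eig_tau r * eig_tau' r = a * b * (\<alpha>\<^sup>2 - \<beta>\<^sup>2)"
      unfolding t ab' by (simp add: power2_eq_square)
    then show ?thesis
      unfolding l using t
      by (intro trace_sigma_log_tau[OF _ _ _ _ _ log_const_def log_slope_def]) auto
  qed
  have 3: "Re (trace (\<sigma> ** log_supp \<tau>)) = coeff0 r + (r * w)\<^sup>2 * coeff2 r"
    unfolding 2 using r(3) by (simp add: coeff0_def coeff2_def field_simps)
  show ?thesis
    unfolding objective_def rel_entropy_def matrix_diff_ldistrib trace_sub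
    using 1 3 by simp
qed

section \<open>Differentiability of the scalar ingredients\<close>

lemma ln_field_differentiable:
  "f field_differentiable at x \<Longrightarrow> 0 < f x \<Longrightarrow> (\<lambda>x. ln (f x :: real)) field_differentiable at x"
  unfolding field_differentiable_def using DERIV_chain2[OF DERIV_ln] by blast

lemma sqrt_field_differentiable:
  "f field_differentiable at x \<Longrightarrow> 0 < f x \<Longrightarrow> (\<lambda>x. sqrt (f x)) field_differentiable at x"
  unfolding field_differentiable_def using DERIV_chain2[OF DERIV_real_sqrt] by blast

lemma disc_sigma_differentiable: "z\<^sup>2 < 1 \<Longrightarrow> disc_sigma field_differentiable at z"
  using disc_sigma_bounds(1)[of z] unfolding disc_sigma_def[abs_def]
  by (intro sqrt_field_differentiable derivative_intros) simp

lemma disc_tau_differentiable: "r\<^sup>2 < 1 \<Longrightarrow> disc_tau field_differentiable at r"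
  using disc_tau_bounds(1)[of r] unfolding disc_tau_def[abs_def]
  by (intro sqrt_field_differentiable derivative_intros) simp

lemma entropy_part_differentiable:
  assumes "z\<^sup>2 < 1" shows "entropy_part field_differentiable at z"
  unfolding entropy_part_def[abs_def] using eig_sigma[OF assms] disc_sigma_differentiable[OF assms]
  unfolding eig_defs
  by (intro derivative_intros ln_field_differentiable) auto

lemma coeff_differentiable:
  assumes "r\<^sup>2 < 1" "r \<noteq> 0"
  shows "coeff0 field_differentiable at r" "coeff2 field_differentiable at r"
proof -
  note D = disc_tau_differentiable[OF assms(1)] and e = eig_tau[OF assms(1)]
  have e': "eig_tau field_differentiable at r" "eig_tau' field_differentiable at r"
    unfolding eig_defs[abs_def] by (intro derivative_intros D; simp)+
  have l: "log_slope field_differentiable at r" "log_const field_differentiable at r"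
    unfolding log_slope_def[abs_def] log_const_def[abs_def]
    by (intro derivative_intros ln_field_differentiable e'; use e in simp)+
  have "\<bar>r\<bar> < 1" using assms by (simp add: abs_square_less_1)
  then have o: "log_off field_differentiable at r"
    unfolding log_off_def[abs_def]
    by (intro derivative_intros ln_field_differentiable) auto
  show "coeff0 field_differentiable at r"
    unfolding coeff0_def[abs_def] log_plus_def[abs_def] by (intro derivative_intros l o)
  show "coeff2 field_differentiable at r"
    unfolding coeff2_def[abs_def] log_minus_def[abs_def] using assms(2)
    by (intro derivative_intros l o) auto
qed

text \<open>If sigma_z = P - Q, then S also lies in the span of P and Q, so \<sigma> and \<tau> act
  on \<sigma>'s range as 2x2 matrices and the logarithms on \<open>off\<close> and
  \<open>off'\<close> drop out. What remains is a trace of 2x2 products against a diagonal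
  matrix.\<close>

lemma (in qubit_channels) trace_pauli_z_Omega:
  assumes Z: "pauli_z = P - Q"
    and l: "0 < l1" "0 < l2" "l1 \<noteq> l2" "l1 + l2 = 1"
    and lprod: "l1 * l2 = q * (1 - q) * (1 - (a - b)\<^sup>2)"
    and m: "0 < m1" "0 < m2" "m1 \<noteq> m2" "m1 + m2 = \<alpha>"
    and mprod: "m1 * m2 = a * b * (\<alpha>\<^sup>2 - \<beta>\<^sup>2)"
  shows "trace (pauli_z ** Omega (dephasing q) (depolarizing p) \<rho>) = of_real ((a - b) *
    ((ln m1 - ln m2) / (m1 - m2) * (\<alpha> - (2 * q - 1) * \<beta>)
      - (ln l1 - ln l2) / (l1 - l2) * (1 - (2 * q - 1)\<^sup>2)))"
proof -
  \<comment> \<open>This is sigma_z times the inverse of \<rho>, the matrix that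
    \<open>trace_mult_Omega\<close> requires for X = sigma_z.\<close>
  define Y where "Y = (1 / a) *\<^sub>R P - (1 / b) *\<^sub>R Q"
  define \<kappa> where "\<kappa> = 2 * q - 1"
  define c0 where "c0 = (m1 * ln m2 - m2 * ln m1) / (m1 - m2)"
  define c1 where "c1 = (ln m1 - ln m2) / (m1 - m2)"
  define e0 where "e0 = (l1 * ln l2 - l2 * ln l1) / (l1 - l2)"
  define e1 where "e1 = (ln l1 - ln l2) / (l1 - l2)"
  have ZPQ: "pauli_z ** P = P" "P ** pauli_z = P" "Q ** pauli_z = - Q"
    unfolding Z matrix_diff_rdistrib matrix_diff_ldistrib PQ by simp_all
  have w: "w = 1"
    by (simp add: w_def ZPQ tr)
  have S: "S = sqrt a *\<^sub>R P - sqrt b *\<^sub>R Q"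
    unfolding S_def R_def matrix_add_rdistrib matrix_scaleR_left ZPQ
    by (simp only: scaleR_minus_right add_uminus_conv_diff)
  have sigma: "\<sigma> = blk P Q a (\<kappa> * s) (\<kappa> * s) b"
  proof -
    have R: "ketbra R R = blk P Q a s s b" and S: "ketbra S S = blk P Q a (- s) (- s) b"
      using ab by (simp_all add: R_def S ketbra_bilinear blk_def s_def algebra_simps)
    have "\<sigma> = q *\<^sub>R ketbra R R + (1 - q) *\<^sub>R ketbra S S"
      by (simp add: sigma_eq blk_def)
    also have "\<dots> = blk P Q a (\<kappa> * s) (\<kappa> * s) b"
      unfolding R S blk_scaleR blk_add by (rule blk_cong) (simp_all add: \<kappa>_def algebra_simps)
    finally show ?thesis .
  qed
  have YPQ: "Y ** P = (1 / a) *\<^sub>R P" "Y ** Q = (- (1 / b)) *\<^sub>R Q"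
    by (simp_all add: Y_def matrix_alg PQ)
  have tY: "trace (tensor Y (mat 1) ** blk P Q x11 x12 x21 x22) = of_real (x11 / a - x22 / b)"
    for x11 x12 x21 x22
  proof -
    from YPQ have "tensor Y (mat 1) ** blk P Q x11 x12 x21 x22 =
        x11 *\<^sub>R ketbra ((1 / a) *\<^sub>R P) P + x12 *\<^sub>R ketbra ((1 / a) *\<^sub>R P) Q
      + x21 *\<^sub>R ketbra ((- (1 / b)) *\<^sub>R Q) P + x22 *\<^sub>R ketbra ((- (1 / b)) *\<^sub>R Q) Q"
      unfolding blk_def matrix_add_ldistrib matrix_scaleR_right tensor_ketbra
      by (simp only: transpose_mat_1 matrix_mul_rid)
    also have "\<dots> = blk P Q (x11 / a) (x12 / a) (- (x21 / b)) (- (x22 / b))"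
      unfolding ketbra_scaleR_left by (simp add: blk_def)
    finally have "tensor Y (mat 1) ** blk P Q x11 x12 x21 x22
      = blk P Q (x11 / a) (x12 / a) (- (x21 / b)) (- (x22 / b))" .
    then show ?thesis by (simp add: trace_blk_PQ)
  qed
  have "\<sigma> ** log_supp \<sigma> = e1 *\<^sub>R (\<sigma> ** \<sigma>) + e0 *\<^sub>R \<sigma>"
    unfolding e0_def e1_def by (rule sigma_log_sigma[OF l]) (simp add: lprod w)
  also have "\<sigma> ** \<sigma> = blk P Q (a * a + \<kappa>\<^sup>2 * (a * b)) (\<kappa> * s) (\<kappa> * s) (\<kappa>\<^sup>2 * (a * b) + b * b)"
  proof -
    have 1: "a * (\<kappa> * s) + \<kappa> * s * b = \<kappa> * s * (a + b)" "\<kappa> * s * a + b * (\<kappa> * s) = \<kappa> * s * (a + b)"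
      by (simp_all add: algebra_simps)
    have 2: "\<kappa> * s * (\<kappa> * s) = \<kappa>\<^sup>2 * (a * b)"
      by (simp add: power2_eq_square flip: s_square)
    show ?thesis
      unfolding sigma blk_PQ_mult 1 2 ab(3) by simp
  qed
  finally have log_sigma: "\<sigma> ** log_supp \<sigma> =
      e1 *\<^sub>R blk P Q (a * a + \<kappa>\<^sup>2 * (a * b)) (\<kappa> * s) (\<kappa> * s) (\<kappa>\<^sup>2 * (a * b) + b * b) + e0 *\<^sub>R \<sigma>" .
  have s1: "trace (tensor Y (mat 1) ** (\<sigma> ** log_supp \<sigma>)) = of_real ((a - b) * (e1 * (1 - \<kappa>\<^sup>2)))"
    unfolding log_sigma unfolding sigma matrix_add_ldistrib matrix_scaleR_right trace_add trace_scaleR tY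
    using ab by (simp add: add_divide_distrib algebra_simps)
  have "log_supp \<tau> = blk P Q (c0 + c1 * \<alpha> * a) (c1 * \<beta> * s) (c1 * \<beta> * s) (c0 + c1 * \<alpha> * b)
    + ln (p / 2 * a) *\<^sub>R off + ln (p / 2 * b) *\<^sub>R off'"
    by (rule log_supp_tau[OF m mprod c0_def c1_def])
  then have "\<sigma> ** log_supp \<tau> =
      blk P Q a (\<kappa> * s) (\<kappa> * s) b ** blk P Q (c0 + c1 * \<alpha> * a) (c1 * \<beta> * s) (c1 * \<beta> * s) (c0 + c1 * \<alpha> * b)"
    unfolding sigma by (simp add: matrix_alg off_mult)
  then have "trace (tensor Y (mat 1) ** (\<sigma> ** log_supp \<tau>))
    = of_real ((a * (c0 + c1 * \<alpha> * a) + \<kappa> * s * (c1 * \<beta> * s)) / a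
        - (\<kappa> * s * (c1 * \<beta> * s) + b * (c0 + c1 * \<alpha> * b)) / b)"
    unfolding blk_PQ_mult by (simp only: tY)
  also have "\<kappa> * s * (c1 * \<beta> * s) = a * b * (\<kappa> * c1 * \<beta>)"
    by (simp add: mult_ac flip: s_square)
  also have "(a * (c0 + c1 * \<alpha> * a) + a * b * (\<kappa> * c1 * \<beta>)) / a
        - (a * b * (\<kappa> * c1 * \<beta>) + b * (c0 + c1 * \<alpha> * b)) / b = (a - b) * (c1 * (\<alpha> - \<kappa> * \<beta>))"
    using ab(1,2) by (simp add: add_divide_distrib) (simp add: field_simps)
  finally have t1: "trace (tensor Y (mat 1) ** (\<sigma> ** log_supp \<tau>)) = of_real ((a - b) * (c1 * (\<alpha> - \<kappa> * \<beta>)))" .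
  have "herm_powr \<rho> (- (1/2)) ** pauli_z = Y ** herm_powr \<rho> (1/2)"
  proof -
    have "x powr (- (1/2)) = (1 / x) * x powr (1/2)" if "0 < x" for x :: real
      using that powr_add[of x "-1" "1/2"] by (simp add: powr_minus_divide)
    then have 1: "a powr (- (1/2)) = (1 / a) * a powr (1/2)" "b powr (- (1/2)) = (1 / b) * b powr (1/2)"
      using ab by auto
    show ?thesis
      unfolding herm_powr_rho 1
      by (simp only: matrix_add_rdistrib matrix_add_ldistrib matrix_scaleR_left
          matrix_scaleR_right ZPQ YPQ scaleR_scaleR scaleR_minus_right scaleR_minus_left
          mult_minus_right mult.commute)
  qed
  then have "trace (pauli_z ** Omega (dephasing q) (depolarizing p) \<rho>) = of_real (- Re (trace
    (tensor Y (mat 1) ** (\<sigma> ** (log_supp \<sigma> - log_supp \<tau>)))))"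
    using trace_mult_Omega[OF pd hermitian_pauli_z, of Y] by simp
  then show ?thesis
    unfolding matrix_diff_ldistrib trace_sub s1 t1
    by (simp add: c1_def e1_def \<kappa>_def algebra_simps)
qed

section \<open>Qubit states\<close>

text \<open>The Euclidean inner product of the type, with respect to which derivatives are computed,
  is the real part of the Hilbert-Schmidt product in \<open>is_gradient\<close>.\<close>

lemma trace_mult_hermitian:
  assumes "hermitian A" shows "Re (trace (A ** B)) = A \<bullet> B"
proof -
  have A: "A $ i $ j = cnj (A $ j $ i)" for i j
    using assms by (simp add: hermitian_def adj_def vec_eq_iff)
  have "trace (A ** B) = (\<Sum>i\<in>UNIV. \<Sum>j\<in>UNIV. cnj (A $ j $ i) * B $ j $ i)"
    by (simp add: trace_def matrix_matrix_mult_def A[symmetric])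
  also have "\<dots> = (\<Sum>j\<in>UNIV. \<Sum>i\<in>UNIV. cnj (A $ j $ i) * B $ j $ i)"
    by (rule sum.swap)
  finally show ?thesis
    by (simp add: inner_vec_def inner_complex_def)
qed

lemma trace_mult_hermitian2:
  assumes "hermitian A" "hermitian B" shows "trace (A ** B) = of_real (A \<bullet> B)"
proof -
  have "cnj (trace (A ** B)) = trace (A ** B)"
    using assms by (subst (2) trace_mul_sym) (simp add: hermitian_def adj_mult flip: trace_adj)
  then have "of_real (Re (trace (A ** B))) = trace (A ** B)"
    by (metis Reals_cnj_iff of_real_Re)
  then show ?thesis by (simp add: trace_mult_hermitian[OF assms(1)])
qed

text \<open>The eigenvalues are positive with sum 1, so Tr(\<rho>^2) = 1 - 2 d1 d2. Equivalently,
  the Bloch radius is less than 1.\<close>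

lemma inner_self_less_one:
  fixes \<rho> :: "complex^2^2"
  assumes "\<rho> \<in> pd_states"
  shows "\<rho> \<bullet> \<rho> < 1"
proof -
  have pd: "positive_definite \<rho>" and tr: "trace \<rho> = 1" using assms by (auto simp: pd_states_def)
  obtain U d where U: "unitary U" and rho: "\<rho> = U ** real_diag d ** adj U" and d: "\<forall>i. 0 < d i"
    using positive_definite_diagonalizable[OF pd] .
  have UU: "adj U ** U = mat 1" using U by (simp add: unitary_def)
  have t: "trace (U ** real_diag e ** adj U) = of_real (\<Sum>i\<in>UNIV. e i)" for e
    by (subst trace_mul_sym) (simp add: matrix_mul_assoc UU, simp add: trace_def real_diag_def)
  have "\<rho> ** \<rho> = U ** (real_diag d ** (adj U ** U) ** real_diag d) ** adj U"
    unfolding rho by (simp only: matrix_mul_assoc)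
  then have "\<rho> ** \<rho> = U ** real_diag (\<lambda>i. d i * d i) ** adj U"
    by (simp add: UU real_diag_mult)
  then have "trace (\<rho> ** \<rho>) = of_real (d 1 * d 1 + d 2 * d 2)"
    by (simp only: t sum_2)
  moreover have "d 1 + d 2 = 1"
    using tr t[of d] unfolding rho[symmetric] by (simp add: sum_2 flip: of_real_add)
  then have "1 = (d 1 + d 2) * (d 1 + d 2)" by simp
  then have "d 1 * d 1 + d 2 * d 2 + 2 * (d 1 * d 2) = 1"
    by (simp add: algebra_simps)
  moreover have "0 < d 1 * d 2" using d by simp
  ultimately show ?thesis
    using pd trace_mult_hermitian[of \<rho> \<rho>] by (simp add: positive_definite_def)
qed

text \<open>Cayley-Hamilton, with the determinant expressed as (1 - Tr(X^2))/2.\<close>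

lemma square_eq_of_trace_one:
  fixes X :: "complex^2^2"
  assumes "trace X = 1" "trace (X ** X) = of_real t"
  shows "X ** X = X - ((1 - t) / 2) *\<^sub>R mat 1"
proof -
  have 22: "X $ 2 $ 2 = 1 - X $ 1 $ 1"
    using assms(1) by (simp add: trace_def sum_2 algebra_simps)
  have t: "of_real t = X $ 1 $ 1 * X $ 1 $ 1 + 2 * (X $ 1 $ 2 * X $ 2 $ 1) + (1 - X $ 1 $ 1) * (1 - X $ 1 $ 1)"
    using assms(2) by (simp add: trace_def sum_2 matrix_matrix_mult_def 22 mult.commute add_ac)
  show ?thesis
    by (simp add: vec_eq_iff forall_2 matrix_matrix_mult_def sum_2 mat_def 22
        scaleR_conv_of_real[where 'a=complex] t) (simp add: field_simps)
qed

text \<open>Obtained from Tr(\<rho>^2) = (1 + r^2)/2; in this form it is visibly differentiable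
  wherever it is positive.\<close>

definition bloch_radius :: "complex^2^2 \<Rightarrow> real" where
  "bloch_radius \<rho> = sqrt (2 * (\<rho> \<bullet> \<rho>) - 1)"

text \<open>The eigenvalues are (1 + r)/2 and (1 - r)/2, and P is the interpolation polynomial
  (\<rho> - b)/(a - b) at \<rho>. The strict inequality excludes the maximally mixed state, where
  this quotient degenerates.\<close>

lemma pd_state_decomposition:
  fixes \<rho> :: "complex^2^2"
  assumes rho: "\<rho> \<in> pd_states" and pos: "1 < 2 * (\<rho> \<bullet> \<rho>)"
  defines "r \<equiv> bloch_radius \<rho>"
  defines "P \<equiv> (1 / r) *\<^sub>R (\<rho> - ((1 - r) / 2) *\<^sub>R mat 1)"
  shows "qubit_state P ((1 + r) / 2) ((1 - r) / 2) \<rho>" "r * Re (trace (pauli_z ** P)) = pauli_z \<bullet> \<rho>"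
    "0 < r"
proof -
  have pd: "positive_definite \<rho>" and tr: "trace \<rho> = 1" and herm: "hermitian \<rho>"
    using rho by (auto simp: pd_states_def positive_definite_def)
  have r: "0 < r" "r < 1" and r2: "r\<^sup>2 = 2 * (\<rho> \<bullet> \<rho>) - 1"
    using pos inner_self_less_one[OF rho] by (auto simp: r_def bloch_radius_def)
  show "0 < r" by (rule r)
  have CH: "\<rho> ** \<rho> = \<rho> - ((1 - (1 + r\<^sup>2) / 2) / 2) *\<^sub>R mat 1"
    by (rule square_eq_of_trace_one[OF tr]) (simp add: trace_mult_hermitian2[OF herm herm] r2)
  have trI: "trace (mat 1 :: complex^2^2) = 2" by (simp add: trace_I)
  show "qubit_state P ((1 + r) / 2) ((1 - r) / 2) \<rho>"
  proof
    show "hermitian P"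
      using herm by (simp add: P_def hermitian_def adj_scaleR adj_diff)
    show "trace P = 1"
      using r by (simp add: P_def trace_linear tr trI field_simps)
    have "(\<rho> - ((1 - r) / 2) *\<^sub>R mat 1) ** (\<rho> - ((1 - r) / 2) *\<^sub>R mat 1)
      = \<rho> ** \<rho> - (1 - r) *\<^sub>R \<rho> + (((1 - r) / 2)\<^sup>2) *\<^sub>R mat 1"
      by (simp add: matrix_alg power2_eq_square algebra_simps flip: scaleR_add_left)
    also have "\<dots> = r *\<^sub>R \<rho> - (((1 - (1 + r\<^sup>2) / 2) / 2) - ((1 - r) / 2)\<^sup>2) *\<^sub>R mat 1"
      unfolding CH by (simp add: algebra_simps)
    also have "((1 - (1 + r\<^sup>2) / 2) / 2) - ((1 - r) / 2)\<^sup>2 = r * ((1 - r) / 2)"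
      by (simp add: power2_eq_square field_simps)
    also have "r *\<^sub>R \<rho> - (r * ((1 - r) / 2)) *\<^sub>R mat 1 = r *\<^sub>R (\<rho> - ((1 - r) / 2) *\<^sub>R mat 1)"
      by (simp add: scaleR_diff_right)
    finally show "P ** P = P"
      using r by (simp add: P_def matrix_scaleR_left matrix_scaleR_right)
    show "0 < (1 + r) / 2" "0 < (1 - r) / 2" "(1 + r) / 2 + (1 - r) / 2 = 1"
      using r by (simp_all add: field_simps)
    have "((1 + r) / 2) *\<^sub>R P + ((1 - r) / 2) *\<^sub>R (mat 1 - P)
      = ((1 + r) / 2 - (1 - r) / 2) *\<^sub>R P + ((1 - r) / 2) *\<^sub>R mat 1"
      by (simp add: algebra_simps)
    also have "(1 + r) / 2 - (1 - r) / 2 = r" by (simp add: field_simps)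
    finally show "\<rho> = ((1 + r) / 2) *\<^sub>R P + ((1 - r) / 2) *\<^sub>R (mat 1 - P)"
      using r by (simp add: P_def)
    show "positive_definite \<rho>" by (rule pd)
  qed
  have "trace pauli_z = 0" by (simp add: trace_def sum_2 pauli_z_nth)
  then have "of_real r * trace (pauli_z ** P) = trace (pauli_z ** \<rho>)"
    using r by (simp add: P_def matrix_alg trace_linear)
  then have "Re (of_real r * trace (pauli_z ** P)) = Re (trace (pauli_z ** \<rho>))" by simp
  then show "r * Re (trace (pauli_z ** P)) = pauli_z \<bullet> \<rho>"
    by (simp add: trace_mult_hermitian[OF hermitian_pauli_z])
qed

lemma objective_eq_bloch:
  assumes "\<rho> \<in> pd_states" "1 < 2 * (\<rho> \<bullet> \<rho>)"
  shows "objective \<rho> = - entropy_part (pauli_z \<bullet> \<rho>) + coeff0 (bloch_radius \<rho>)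
    + (pauli_z \<bullet> \<rho>)\<^sup>2 * coeff2 (bloch_radius \<rho>)"
proof -
  define P where "P = (1 / bloch_radius \<rho>) *\<^sub>R (\<rho> - ((1 - bloch_radius \<rho>) / 2) *\<^sub>R mat 1)"
  note D = pd_state_decomposition[OF assms, folded P_def]
  from D(3) qubit_state.objective_eq[OF D(1) refl refl] show ?thesis
    by (simp add: qubit_state.w_def[OF D(1)] D(2))
qed

section \<open>States on the axis of the Bloch ball\<close>

definition axis_state :: "real \<Rightarrow> complex^2^2" where
  "axis_state t = (1/2) *\<^sub>R (mat 1 + t *\<^sub>R pauli_z)"

lemma inner_mat_pauli:
  "mat 1 \<bullet> (mat 1 :: complex^2^2) = 2" "mat 1 \<bullet> pauli_z = 0" "pauli_z \<bullet> mat 1 = 0"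
  "pauli_z \<bullet> pauli_z = 2"
  by (simp_all add: inner_vec_def sum_2 mat_def pauli_z_nth inner_complex_def)

lemma inner_axis_state:
  "axis_state t \<bullet> axis_state t = (1 + t\<^sup>2) / 2" "pauli_z \<bullet> axis_state t = t"
  "axis_state t \<bullet> X = (mat 1 \<bullet> X + t * (pauli_z \<bullet> X)) / 2"
  by (simp_all add: axis_state_def inner_add_left inner_add_right inner_mat_pauli
      power2_eq_square field_simps)

lemma hermitian_axis_state: "hermitian (axis_state t)"
  using hermitian_pauli_z by (simp add: axis_state_def hermitian_def adj_scaleR adj_add)

lemma axis_state_pd:
  assumes "\<bar>t\<bar> < 1" shows "axis_state t \<in> pd_states"
proof -
  have t: "0 < (1 + t) / 2" "0 < (1 - t) / 2" using assms by (auto simp: abs_less_iff)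
  have "0 < Re (\<Sum>i\<in>UNIV. cnj (v $ i) * (axis_state t *v v) $ i)" if "v \<noteq> 0" for v
  proof -
    have nth: "(axis_state t *v v) $ 1 = of_real ((1 + t) / 2) * v $ 1"
      "(axis_state t *v v) $ 2 = of_real ((1 - t) / 2) * v $ 2"
      by (simp_all add: axis_state_def matrix_vector_mult_def sum_2 mat_def pauli_z_nth
          scaleR_conv_of_real[where 'a=complex])
    have "Re (\<Sum>i\<in>UNIV. cnj (v $ i) * (axis_state t *v v) $ i)
      = (1 + t) / 2 * ((Re (v $ 1))\<^sup>2 + (Im (v $ 1))\<^sup>2) + (1 - t) / 2 * ((Re (v $ 2))\<^sup>2 + (Im (v $ 2))\<^sup>2)"
      unfolding sum_2 nth by (simp add: power2_eq_square field_simps)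
    moreover have "v $ 1 \<noteq> 0 \<or> v $ 2 \<noteq> 0"
      using that by (auto simp: vec_eq_iff forall_2)
    then have "0 < (Re (v $ 1))\<^sup>2 + (Im (v $ 1))\<^sup>2 \<or> 0 < (Re (v $ 2))\<^sup>2 + (Im (v $ 2))\<^sup>2"
      by (auto simp: complex_eq_iff sum_power2_gt_zero_iff)
    then have "0 < (1 + t) / 2 * ((Re (v $ 1))\<^sup>2 + (Im (v $ 1))\<^sup>2)
        + (1 - t) / 2 * ((Re (v $ 2))\<^sup>2 + (Im (v $ 2))\<^sup>2)"
    proof
      assume "0 < (Re (v $ 1))\<^sup>2 + (Im (v $ 1))\<^sup>2"
      then show ?thesis
        using t by (intro add_pos_nonneg[OF mult_pos_pos mult_nonneg_nonneg]) simp_all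
    next
      assume "0 < (Re (v $ 2))\<^sup>2 + (Im (v $ 2))\<^sup>2"
      then show ?thesis
        using t by (intro add_nonneg_pos[OF mult_nonneg_nonneg mult_pos_pos]) simp_all
    qed
    ultimately show ?thesis by simp
  qed
  moreover have "trace (axis_state t) = 1"
    by (simp add: axis_state_def trace_linear trace_I) (simp add: trace_def sum_2 pauli_z_nth)
  ultimately show ?thesis
    using hermitian_axis_state by (simp add: pd_states_def positive_definite_def)
qed

lemma bloch_radius_axis_state: "0 \<le> t \<Longrightarrow> bloch_radius (axis_state t) = t"
  by (simp add: bloch_radius_def inner_axis_state(1) add_divide_distrib)

text \<open>Near the axis state the objective is a differentiable function of z and r. At that state
  both differentials are the pairing with sigma_z on traceless directions, so the gradient is a
  multiple of sigma_z.\<close>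

lemma objective_gradient_exists: "\<exists>G. is_gradient objective (axis_state (1/2)) G"
proof -
  let ?\<rho> = "axis_state (1/2)" and ?F = "at (axis_state (1/2)) within pd_states"
  have half: "(1/2 :: real)\<^sup>2 < 1" "(1/2 :: real) \<noteq> 0" by (simp_all add: power2_eq_square)
  obtain A' B' C' where "(entropy_part has_real_derivative A') (at (1/2))"
    "(coeff0 has_real_derivative B') (at (1/2))" "(coeff2 has_real_derivative C') (at (1/2))"
    using entropy_part_differentiable[OF half(1)] coeff_differentiable[OF half]
    by (auto simp: field_differentiable_def)
  then have A: "(entropy_part has_real_derivative A') (at (pauli_z \<bullet> ?\<rho>))"
    and B: "(coeff0 has_real_derivative B') (at (bloch_radius ?\<rho>))"
    and C: "(coeff2 has_real_derivative C') (at (bloch_radius ?\<rho>))"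
    by (simp_all add: inner_axis_state(1,2) bloch_radius_axis_state)
  have z: "((\<lambda>\<rho>. pauli_z \<bullet> \<rho>) has_derivative (\<lambda>X. pauli_z \<bullet> X)) ?F"
    by (rule has_derivative_inner_right[OF has_derivative_ident])
  have q: "((\<lambda>\<rho>. 2 * (\<rho> \<bullet> \<rho>) - 1) has_derivative (\<lambda>X. 4 * (?\<rho> \<bullet> X))) ?F"
    by (auto intro!: derivative_eq_intros simp: inner_commute)
  \<comment> \<open>At t = 1/2 the argument r^2 is 1/4, where the square root has derivative exactly
    1.\<close>
  have "(sqrt has_real_derivative 1) (at (2 * (?\<rho> \<bullet> ?\<rho>) - 1))"
    using DERIV_real_sqrt[of "1/4"] by (simp add: inner_axis_state(1) power2_eq_square real_sqrt_divide)
  from DERIV_compose_FDERIV[OF this q]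
  have r: "(bloch_radius has_derivative (\<lambda>X. 4 * (?\<rho> \<bullet> X))) ?F"
    by (simp add: bloch_radius_def[abs_def])
  have sq: "((\<lambda>\<rho>. (pauli_z \<bullet> \<rho>)\<^sup>2) has_derivative (\<lambda>X. pauli_z \<bullet> X)) ?F"
    by (rule has_derivative_eq_rhs[OF has_derivative_power[OF z]]) (simp add: inner_axis_state(1,2))
  \<comment> \<open>The formula makes sense for every matrix and can be differentiated freely; it is
    known to agree with \<open>objective\<close> only on states near the base point, which suffices
    for the derivative within \<open>pd_states\<close>.\<close>
  define g where "g \<rho> = - entropy_part (pauli_z \<bullet> \<rho>) + coeff0 (bloch_radius \<rho>)
    + (pauli_z \<bullet> \<rho>)\<^sup>2 * coeff2 (bloch_radius \<rho>)" for \<rho>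
  note D = has_derivative_add[OF has_derivative_add[OF
      has_derivative_minus[OF DERIV_compose_FDERIV[OF A z]] DERIV_compose_FDERIV[OF B r]]
      has_derivative_mult[OF sq DERIV_compose_FDERIV[OF C r]]]
  define g' where "g' X = - ((pauli_z \<bullet> X) * A') + 4 * (?\<rho> \<bullet> X) * B'
    + ((pauli_z \<bullet> ?\<rho>)\<^sup>2 * (4 * (?\<rho> \<bullet> X) * C') + (pauli_z \<bullet> X) * coeff2 (bloch_radius ?\<rho>))" for X
  have g: "(g has_derivative g') ?F"
    unfolding g_def[abs_def] g'_def[abs_def] by (rule D)
  have "open {\<rho> :: complex^2^2. 1 < 2 * (\<rho> \<bullet> \<rho>)}"
    by (intro open_Collect_less continuous_intros)
  then obtain d where d: "0 < d" "ball ?\<rho> d \<subseteq> {\<rho>. 1 < 2 * (\<rho> \<bullet> \<rho>)}"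
    by (rule openE[where x = ?\<rho>]) (simp add: inner_axis_state(1,2) power2_eq_square)
  have f: "(objective has_derivative g') ?F"
  proof (rule has_derivative_transform_within[OF g d(1)])
    show "?\<rho> \<in> pd_states" by (rule axis_state_pd) simp
    fix \<rho> assume "\<rho> \<in> pd_states" "dist \<rho> ?\<rho> < d"
    then show "g \<rho> = objective \<rho>"
      using d(2) unfolding g_def by (subst objective_eq_bloch) (auto simp: dist_commute)
  qed
  \<comment> \<open>C'/4 carries z^2 = 1/4, and the last coefficient is 1 because 2 z = 1.\<close>
  define K where "K = - A' + B' + C' / 4 + coeff2 (1/2)"
  have "complex_of_real (g' X) = trace (X ** (K *\<^sub>R pauli_z))" if X: "hermitian X" "trace X = 0" for X
  proof -
    have "mat 1 \<bullet> X = 0"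
      using trace_mult_hermitian[of "mat 1" X] X by (simp add: hermitian_def)
    then have "g' X = K * (pauli_z \<bullet> X)"
      by (simp add: g'_def inner_axis_state(2,3) bloch_radius_axis_state K_def power2_eq_square field_simps)
    then show ?thesis
      using trace_mult_hermitian2[OF X(1) hermitian_pauli_z]
      by (simp add: matrix_scaleR_right trace_scaleR inner_commute)
  qed
  then have "is_gradient objective ?\<rho> (K *\<^sub>R pauli_z)"
    unfolding is_gradient_def using f hermitian_scaleR[OF hermitian_pauli_z] by blast
  then show ?thesis by blast
qed

text \<open>The segment stays inside \<open>pd_states\<close>, so the chain rule applies to the
  derivative relative to that set. Its velocity is sigma_z / 2, whence the factor 2.\<close>

lemma gradient_along_axis:
  assumes G: "is_gradient f (axis_state t) G" and t: "\<bar>t\<bar> < 1"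
    and D: "((\<lambda>s. f (axis_state s)) has_real_derivative D) (at t)"
  shows "trace (pauli_z ** G) = of_real (2 * D)"
proof -
  obtain f' where f': "(f has_derivative f') (at (axis_state t) within pd_states)"
    and tr: "\<And>X. hermitian X \<Longrightarrow> trace X = 0 \<Longrightarrow> complex_of_real (f' X) = trace (X ** G)"
    using G by (auto simp: is_gradient_def)
  have t1: "t \<in> {-1<..<1}" using t by auto
  have "(axis_state has_derivative (\<lambda>h. (h / 2) *\<^sub>R pauli_z)) (at t within {-1<..<1})"
    unfolding axis_state_def[abs_def] by (auto intro!: derivative_eq_intros)
  moreover have "(f has_derivative f') (at (axis_state t) within axis_state ` {-1<..<1})"
    by (rule has_derivative_subset[OF f']) (auto intro!: axis_state_pd simp: abs_less_iff)
  ultimately have "((\<lambda>s. f (axis_state s)) has_derivative (\<lambda>h. f' ((h / 2) *\<^sub>R pauli_z))) (at t)"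
    using has_derivative_in_compose at_within_open[OF t1] by fastforce
  then have "(\<lambda>h. f' ((h / 2) *\<^sub>R pauli_z)) = (*) D"
    using D has_derivative_unique by (auto simp: has_field_derivative_def)
  from fun_cong[OF this, of 2] have "f' pauli_z = 2 * D" by simp
  moreover have "trace pauli_z = 0" by (simp add: trace_def sum_2 pauli_z_nth)
  ultimately show ?thesis using tr[OF hermitian_pauli_z] by simp
qed

text \<open>Here a - b = 1/2, which halves \<alpha> - (2q - 1) \<beta> = 233/200 and 1 - (2q - 1)^2
  = 24/25.\<close>

lemma trace_pauli_z_Omega_axis:
  "trace (pauli_z ** Omega (dephasing (2/5)) (depolarizing (1/20)) (axis_state (1/2))) =
    of_real (233/400 * log_slope (1/2)
      - 12/25 * ((ln (eig_sigma (1/2)) - ln (eig_sigma' (1/2))) / disc_sigma (1/2)))"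
proof -
  define P where "P = (1/2) *\<^sub>R (mat 1 + pauli_z)"
  interpret qubit_channels P "3/4" "1/4" "axis_state (1/2)" "1/20" "2/5"
  proof
    show "hermitian P" using hermitian_axis_state[of 1] by (simp add: P_def axis_state_def)
    show "trace P = 1"
      by (simp add: P_def trace_linear trace_I) (simp add: trace_def sum_2 pauli_z_nth)
    have "(mat 1 + pauli_z) ** (mat 1 + pauli_z) = 2 *\<^sub>R (mat 1 + pauli_z)"
      by (simp add: matrix_add_ldistrib matrix_add_rdistrib pauli_z_square scaleR_2 add_ac)
    then show "P ** P = P"
      by (simp add: P_def matrix_scaleR_left matrix_scaleR_right)
    show "axis_state (1/2) = (3/4) *\<^sub>R P + (1/4) *\<^sub>R (mat 1 - P)"
      by (simp add: P_def axis_state_def vec_eq_iff mat_def scaleR_conv_of_real[where 'a=complex] field_simps)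
    show "positive_definite (axis_state (1/2))"
      using axis_state_pd[of "1/2"] by (simp add: pd_states_def)
  qed auto
  have Z: "pauli_z = P - Q"
    by (simp add: P_def vec_eq_iff mat_def scaleR_conv_of_real[where 'a=complex] field_simps)
  have half: "(1/2 :: real)\<^sup>2 < 1" by (simp add: power2_eq_square)
  note s = eig_sigma[OF half] and t = eig_tau[OF half]
  have d: "eig_sigma (1/2) - eig_sigma' (1/2) = disc_sigma (1/2)"
    by (simp add: eig_defs field_simps)
  show ?thesis
    by (subst trace_pauli_z_Omega[OF Z s(1-4) _ t(1-3)])
       (use s(5) t(4,5) in \<open>simp_all add: power2_eq_square log_slope_def d field_simps\<close>)
qed

text \<open>On the axis w = 1, so \<open>log_off\<close> cancels. The logarithms of the two
  eigenvalues of \<tau> are written as half sum plus or minus half difference: the half sum is half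
  the logarithm of the determinant of the block, and the difference over the gap multiplies a
  polynomial in t^2.\<close>

lemma objective_axis_state:
  assumes "0 < t" "t < 1"
  shows "objective (axis_state t) = - entropy_part t + ln (77/6400 * (1 - t\<^sup>2)) / 2
    + (ln (eig_tau t) - ln (eig_tau' t)) / disc_tau t * (233/400 * t\<^sup>2 - 19/200)"
proof -
  have t2: "t\<^sup>2 < 1" using assms by (simp add: abs_square_less_1)
  note e = eig_tau[OF t2]
  have "0 < t\<^sup>2" using assms by simp
  then have "objective (axis_state t) = - entropy_part t + coeff0 t + t\<^sup>2 * coeff2 t"
    using assms axis_state_pd[of t]
    by (subst objective_eq_bloch) (simp_all add: inner_axis_state(1,2) bloch_radius_axis_state)
  also have "\<dots> = - entropy_part t + (2/5 * log_plus t + 3/5 * log_minus t)"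
    using assms by (simp add: coeff0_def coeff2_def field_simps)
  also have "2/5 * log_plus t + 3/5 * log_minus t
    = log_const t + log_slope t * (39/80 * (1 + t\<^sup>2) - 19/200 * (1 - t\<^sup>2))"
    by (simp add: log_plus_def log_minus_def field_simps)
  also have "log_const t = (ln (eig_tau t) + ln (eig_tau' t)) / 2 - 39/80 * log_slope t"
    using disc_tau_bounds(1)[OF t2]
    by (simp add: log_const_def log_slope_def eig_tau_def[of t] eig_tau'_def[of t] 
       field_simps)
  also have "ln (eig_tau t) + ln (eig_tau' t) = ln (77/6400 * (1 - t\<^sup>2))"
    unfolding e(5)[symmetric] using e(1,2) by (simp add: ln_mult)
  also have "log_slope t = (ln (eig_tau t) - ln (eig_tau' t)) / disc_tau t"
    by (simp add: log_slope_def) (simp add: eig_defs field_simps)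
  finally have "objective (axis_state t) = - entropy_part t + (ln (77/6400 * (1 - t\<^sup>2)) / 2
    - 39/80 * ((ln (eig_tau t) - ln (eig_tau' t)) / disc_tau t)
    + (ln (eig_tau t) - ln (eig_tau' t)) / disc_tau t * (39/80 * (1 + t\<^sup>2) - 19/200 * (1 - t\<^sup>2)))" .
  moreover have "l - 39/80 * x + x * (39/80 * (1 + t\<^sup>2) - 19/200 * (1 - t\<^sup>2))
      = l + x * (233/400 * t\<^sup>2 - 19/200)" for l x :: real
    by (simp add: field_simps)
  ultimately show ?thesis by (simp only: add.assoc)
qed

section \<open>Derivatives along the axis at t = 1/2\<close>

lemma DERIV_disc:
  "(disc_sigma has_real_derivative 12/25 / disc_sigma (1/2)) (at (1/2))"
  "(disc_tau has_real_derivative 77/3200 / disc_tau (1/2)) (at (1/2))"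
proof -
  show "(disc_sigma has_real_derivative 12/25 / disc_sigma (1/2)) (at (1/2))"
    unfolding disc_sigma_def[abs_def]
    by (auto intro!: derivative_eq_intros simp: power2_eq_square field_simps)
  show "(disc_tau has_real_derivative 77/3200 / disc_tau (1/2)) (at (1/2))"
    unfolding disc_tau_def[abs_def]
    by (auto intro!: derivative_eq_intros simp: power2_eq_square field_simps)
qed

text \<open>The eigenvalues sum to 1, so the derivatives of x ln x leave only the difference of
  logarithms. Twice 6/25 is the 12/25 in \<open>trace_pauli_z_Omega_axis\<close>: the \<sigma> parts
  of derivative and \<open>Omega\<close> coincide.\<close>

lemma DERIV_entropy_part:
  "(entropy_part has_real_derivative
    6/25 * ((ln (eig_sigma (1/2)) - ln (eig_sigma' (1/2))) / disc_sigma (1/2))) (at (1/2))"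
proof -
  have half: "(1/2 :: real)\<^sup>2 < 1" by (simp add: power2_eq_square)
  note s = eig_sigma[OF half]
  have d: "(eig_sigma has_real_derivative 6/25 / disc_sigma (1/2)) (at (1/2))"
    "(eig_sigma' has_real_derivative - (6/25 / disc_sigma (1/2))) (at (1/2))"
    unfolding eig_sigma_def[abs_def] eig_sigma'_def[abs_def]
    by (auto intro!: derivative_eq_intros DERIV_disc)
  show ?thesis
    unfolding entropy_part_def[abs_def]
    by (rule derivative_eq_intros d refl s)+
       (use s in \<open>simp add: field_simps, simp add: diff_divide_distrib\<close>)
qed

text \<open>At t = 1/2: -2/3 comes from ln(1 - t^2)/2, 81/1600 is the value of 233/400 t^2 - 19/200,
  and 13/10 = (39/40)/(3/4) comes from the sum of the eigenvalues of the block over their product,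
  after 77/6400 cancels.\<close>

lemma objective_axis_derivative:
  defines "\<delta> \<equiv> disc_tau (1/2)" and "L \<equiv> ln (eig_tau (1/2)) - ln (eig_tau' (1/2))"
  shows "((\<lambda>t. objective (axis_state t)) has_real_derivative
    - (6/25 * ((ln (eig_sigma (1/2)) - ln (eig_sigma' (1/2))) / disc_sigma (1/2)))
    - 2/3 + 233/400 * (L / \<delta>) + 81/1600 * ((13/10 - 77/3200 * (L / \<delta>)) / \<delta>\<^sup>2)) (at (1/2))"
proof -
  have half: "(1/2 :: real)\<^sup>2 < 1" by (simp add: power2_eq_square)
  note e = eig_tau[OF half] and \<delta> = disc_tau_bounds(1)[OF half, folded \<delta>_def]
  have d: "(eig_tau has_real_derivative 77/6400 / \<delta>) (at (1/2))"
    "(eig_tau' has_real_derivative - (77/6400 / \<delta>)) (at (1/2))"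
    unfolding eig_tau_def[abs_def] eig_tau'_def[abs_def] \<delta>_def
    by (auto intro!: derivative_eq_intros DERIV_disc)
  have "((\<lambda>t. ln (eig_tau t) - ln (eig_tau' t)) has_real_derivative 13/10 / \<delta>) (at (1/2))"
  proof -
    have "77/6400 / \<delta> * (1 / eig_tau (1/2)) - (- (77/6400 / \<delta>)) * (1 / eig_tau' (1/2))
      = 77/6400 / \<delta> * ((eig_tau (1/2) + eig_tau' (1/2)) / (eig_tau (1/2) * eig_tau' (1/2)))"
      using e by (simp add: add_divide_distrib) (simp add: algebra_simps)
    also have "\<dots> = 13/10 / \<delta>"
      unfolding e(4,5) by (simp add: power2_eq_square)
    finally show ?thesis
      using e by (auto intro!: derivative_eq_intros d simp: mult.commute)
  qed
  then have q: "((\<lambda>t. (ln (eig_tau t) - ln (eig_tau' t)) / disc_tau t) has_real_derivative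
      (13/10 - 77/3200 * (L / \<delta>)) / \<delta>\<^sup>2) (at (1/2))"
    by (rule DERIV_cong[OF DERIV_divide[OF _ DERIV_disc(2)]])
       (use \<delta> in \<open>simp_all add: power2_eq_square mult.commute flip: \<delta>_def L_def\<close>)
  have l: "((\<lambda>t. ln (77/6400 * (1 - t\<^sup>2)) / 2) has_real_derivative - (2/3)) (at (1/2))"
    by (auto intro!: derivative_eq_intros simp: power2_eq_square)
  have n: "((\<lambda>t. 233/400 * t\<^sup>2 - 19/200) has_real_derivative 233/400) (at (1/2 :: real))"
    by (auto intro!: derivative_eq_intros)
  have "((\<lambda>t. - entropy_part t + ln (77/6400 * (1 - t\<^sup>2)) / 2
    + (ln (eig_tau t) - ln (eig_tau' t)) / disc_tau t * (233/400 * t\<^sup>2 - 19/200)) has_real_derivative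
    - (6/25 * ((ln (eig_sigma (1/2)) - ln (eig_sigma' (1/2))) / disc_sigma (1/2)))
    - 2/3 + 233/400 * (L / \<delta>) + 81/1600 * ((13/10 - 77/3200 * (L / \<delta>)) / \<delta>\<^sup>2)) (at (1/2))"
    by (rule DERIV_cong[OF DERIV_add[OF DERIV_add[OF DERIV_minus[OF DERIV_entropy_part] l]
          DERIV_mult[OF q n]]])
       (simp add: L_def \<delta>_def power2_eq_square)
  then show ?thesis
    by (rule has_field_derivative_transform_within_open[where S = "{0<..<1}"])
       (auto simp: objective_axis_state)
qed

text \<open>The right-hand side is twice the derivative of \<open>objective\<close> along the axis and the left-hand
  side the corresponding component of \<open>Omega\<close>, the equal contributions of \<open>\<sigma>\<close> being omitted.\<close>

lemma derivative_gap:
  defines "\<delta> \<equiv> disc_tau (1/2)" and "L \<equiv> ln (eig_tau (1/2)) - ln (eig_tau' (1/2))"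
  shows "233/400 * (L / \<delta>)
    < 2 * (- 2/3 + 233/400 * (L / \<delta>) + 81/1600 * ((13/10 - 77/3200 * (L / \<delta>)) / \<delta>\<^sup>2))"
proof -
  have half: "(1/2 :: real)\<^sup>2 < 1" by (simp add: power2_eq_square)
  note e = eig_tau[OF half]
  have d2: "\<delta>\<^sup>2 = 5853/6400"
    using disc_tau_bounds(3)[OF half] by (simp add: \<delta>_def power2_eq_square)
  have "19/20 \<le> \<delta>"
    by (rule power2_le_imp_le) (use d2 disc_tau_bounds(1)[OF half] in \<open>simp_all add: \<delta>_def power2_eq_square\<close>)
  \<comment> \<open>With this bound on the gap the eigenvalue ratio is at least 77; the weaker bound
    27 = 3^3 suffices, since e < 3 already gives L >= 3.\<close>
  then have "27 * eig_tau' (1/2) \<le> eig_tau (1/2)"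
    by (simp add: eig_tau_def eig_tau'_def \<delta>_def)
  then have "ln (27 * eig_tau' (1/2)) \<le> ln (eig_tau (1/2))"
    using e by (subst ln_le_cancel_iff) auto
  then have "ln 27 \<le> L" using e by (simp add: L_def ln_mult)
  moreover have "exp (1 :: real) ^ 3 \<le> 3 ^ 3"
    by (intro power_mono exp_le) simp
  then have "exp (3 :: real) \<le> 27" by (simp flip: exp_of_nat_mult)
  then have "3 \<le> ln (27 :: real)" by (simp add: ln_ge_iff)
  ultimately have L: "3 \<le> L" by simp
  have "\<delta> \<le> 1" by (rule power2_le_imp_le) (simp_all add: d2)
  moreover have "0 < \<delta>" using \<open>19/20 \<le> \<delta>\<close> by simp
  ultimately have "3 \<le> L / \<delta>" using L by (simp add: le_divide_eq)
  \<comment> \<open>The difference of the two sides is affine in x with positive slope and already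
    positive at x = 3.\<close>
  moreover have "233/400 * x < 2 * (- 2/3 + 233/400 * x + 81/1600 * ((13/10 - 77/3200 * x) / (5853/6400)))"
    if "3 \<le> x" for x :: real
    using that by (simp add: diff_divide_distrib)
  ultimately show ?thesis unfolding d2 by blast
qed

text \<open>A gradient is asserted to exist at the witness because the universal statement over G
  would otherwise hold vacuously; quantifying over all G covers the freedom of adding multiples of
  I.\<close>

theorem theorem18:
  fixes p q :: real
    and \<N>\<^sub>1 \<N>\<^sub>2 :: "complex^2^2 \<Rightarrow> complex^2^2"
    and f :: "complex^2^2 \<Rightarrow> real"
  assumes "p = 0.05" and "q = 0.4"
    and "\<N>\<^sub>1 = dephasing q" and "\<N>\<^sub>2 = depolarizing p"
    and "f = (\<lambda>\<rho>. - rel_entropy (sandwich \<N>\<^sub>1 \<rho>) (sandwich \<N>\<^sub>2 \<rho>))"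
  shows "(\<forall>\<rho>\<in>pd_states. complex_of_real (f \<rho>) = trace (\<rho> ** Omega \<N>\<^sub>1 \<N>\<^sub>2 \<rho>)) \<and>
         (\<exists>\<rho>\<in>pd_states. (\<exists>G. is_gradient f \<rho> G) \<and>
            (\<forall>G. is_gradient f \<rho> G \<longrightarrow> Omega \<N>\<^sub>1 \<N>\<^sub>2 \<rho> - G \<notin> N_M))"
proof (intro conjI ballI bexI[of _ "axis_state (1/2)"] allI impI notI)
  have N: "\<N>\<^sub>1 = dephasing (2/5)" "\<N>\<^sub>2 = depolarizing (1/20)"
    unfolding assms by simp_all
  have f: "f = objective"
    by (simp add: fun_eq_iff objective_def assms(5) N)
  show "complex_of_real (f \<rho>) = trace (\<rho> ** Omega \<N>\<^sub>1 \<N>\<^sub>2 \<rho>)" if "\<rho> \<in> pd_states" for \<rho>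
    using that by (simp add: pd_states_def trace_Omega assms(5))
  show "axis_state (1/2) \<in> pd_states" by (rule axis_state_pd) simp
  show "\<exists>G. is_gradient f (axis_state (1/2)) G"
    unfolding f by (rule objective_gradient_exists)
  fix G assume G: "is_gradient f (axis_state (1/2)) G"
    and "Omega \<N>\<^sub>1 \<N>\<^sub>2 (axis_state (1/2)) - G \<in> N_M"
  then obtain c :: real where c: "Omega \<N>\<^sub>1 \<N>\<^sub>2 (axis_state (1/2)) - G = c *\<^sub>R mat 1"
    by (auto simp: N_M_def)
  \<comment> \<open>Tracelessness of sigma_z removes the unknown c, which leaves an equation between
    two explicit real numbers that \<open>derivative_gap\<close> contradicts.\<close>
  have "trace (pauli_z ** (Omega \<N>\<^sub>1 \<N>\<^sub>2 (axis_state (1/2)) - G)) = 0"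
    unfolding c by (simp add: matrix_scaleR_right trace_scaleR) (simp add: trace_def sum_2 pauli_z_nth)
  then have "trace (pauli_z ** Omega \<N>\<^sub>1 \<N>\<^sub>2 (axis_state (1/2))) = trace (pauli_z ** G)"
    by (simp add: matrix_diff_ldistrib trace_sub)
  moreover note gradient_along_axis[OF G[unfolded f] _ objective_axis_derivative]
  moreover have "log_slope (1/2) = (ln (eig_tau (1/2)) - ln (eig_tau' (1/2))) / disc_tau (1/2)"
    by (simp add: log_slope_def) (simp add: eig_defs field_simps)
  ultimately show False
    using derivative_gap unfolding N trace_pauli_z_Omega_axis
    by (simp only: of_real_eq_iff) (simp add: algebra_simps)
qed

end
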